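(* Let $c\ge1$ be an integer and $\mu,\nu\in\mathbb R$ with $\mu\neq0$ and $\nu\neq0$. Let $\nabla^1$ be the compatible connection on $\Xi$, with constant curvature $\Theta_{\nabla^1}(X,Y)=\nu i\,\mathrm{Id}_E$, $\Theta_{\nabla^1}(X,Z)=0$, $\Theta_{\nabla^1}(Y,Z)=\frac{\pi i}{\mu}\mathrm{Id}_E$, given by $$(\nabla^1_Xf)(x,y)=-\frac{\partial f}{\partial y}(x,y)+\Big(\frac{\pi c i}{2\mu}x^2-\nu i x+\mu i y\Big)f(x,y),$$ $$(\nabla^1_Yf)(x,y)=-\frac{\partial f}{\partial x}(x,y),\qquad (\nabla^1_Zf)(x,y)=\frac{\pi i x}{\mu}f(x,y).$$ Then $\nabla^1$ is neither a critical point nor a minimizer of the Yang–Mills functional $\mathrm{YM}$ on the set $CC(\Xi)$ of compatible connections on $\Xi$.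
   Context: Notation: $e(t)=\exp(2\pi i t)$, $\bar e(t)=\overline{e(t)}$, $\mathbb T=\mathbb R/\mathbb Z$, $M=\mathbb R\times\mathbb T$, $\delta_0(p)=1$ if $p=0$ and $0$ otherwise. $\mathfrak h$ is the Heisenberg Lie algebra with basis $\{X,Y,Z\}$, $[X,Y]=cZ$, $Z$ central. Algebras. $\mathbb Z$ acts on $M$ by $\lambda_p(x,y)=(x+2p\mu,y+2p\nu)$ and $\sigma_p(x,y)=(x-p,y)$. In $C_b(M)\rtimes_\lambda\mathbb Z$: $(\Phi\ast\Psi)(x,y,p)=\sum_q\Phi(x,y,q)\Psi(x-2q\mu,y-2q\nu,p-q)$, $\Phi^*(x,y,p)=\overline{\Phi}(x-2p\mu,y-2p\nu,-p)$. In $C_b(M)\rtimes_\sigma\mathbb Z$: $(\Phi\ast\Psi)(x,y,p)=\sum_q\Phi(x,y,q)\Psi(x+q,y,p-q)$, $\Phi^*(x,y,p)=\overline\Phi(x+p,y,-p)$. The quantum Heisenberg manifold $D^c_{\mu\nu}$ is the closure, in the multiplier algebra of $C_b(M)\rtimes_\lambda\mathbb Z$, of the $*$-algebra $D_0$ of bounded continuous functions $\Phi$ on $M\times\mathbb Z$ with compact support in $\mathbb Z$ and $\bar e(ckp(y-p\nu))\Phi(x+k,y,p)=\Phi(x,y,p)$ for all $k\in\mathbb Z$. $E^c_{\mu\nu}$ is the closure, in the multiplier algebra of $C_b(M)\rtimes_\sigma\mathbb Z$, of the $*$-algebra $E_0$ of bounded continuous functions $\Psi$ on $M\times\mathbb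 Z$ with compact support in $\mathbb Z$ and $e(cpk(y-k\nu))\Psi(x-2k\mu,y-2k\nu,p)=\Psi(x,y,p)$ for all $k\in\mathbb Z$. $\mathrm{Id}_E(x,y,p)=\delta_0(p)$ is the identity of $E^c_{\mu\nu}$. Bimodule. $\Xi$ is the $E^c_{\mu\nu}$–$D^c_{\mu\nu}$ equivalence bimodule obtained by completing $C_c(\mathbb R\times\mathbb T)$ for $\langle f,g\rangle_R^D(x,y,p)=\sum_k\bar e(ckp(y-p\nu))f(x+k,y)\overline g(x-2p\mu+k,y-2p\nu)$, $\langle f,g\rangle_L^E(x,y,p)=\sum_k e(cpk(y-k\nu))\overline f(x-2k\mu,y-2k\nu)g(x-2k\mu+p,y-2k\nu)$, with actions $(\Psi\cdot f)(x,y)=\sum_q\overline\Psi(x,y,q)f(x+q,y)$ and $(g\cdot\Phi)(x,y)=\sum_q g(x+2q\mu,y+2q\nu)\overline\Phi(x+2q\mu,y+2q\nu,q)$. Derivations. $\mathfrak h$ acts on the smooth subalgebra of $D^c_{\mu\nu}$ by $\delta_X(\Phi)=2\pi i c p(x-p\mu)\Phi-\frac{\partial\Phi}{\partial y}$, $\delta_Y(\Phi)=-\frac{\partial\Phi}{\partial x}$, $\delta_Z(\Phi)=2\pi i p\,\Phi$ at $(x,y,p)$. By convention all algebras and modules are replaced by their smooth dense versions, with no change in notation. Connections. A linear connection on $\Xi$ is a linear map $\nabla:\Xi\to\Xi\otimes\mathfrak h^*$ with $\nabla_W(\xi\cdot\Phi)=\nabla_W(\xi)\cdot\Phi+\xi\cdot\delta_W(\Phi)$;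 it is compatible if $\delta_W(\langle\xi,\eta\rangle_R^D)=\langle\nabla_W\xi,\eta\rangle_R^D+\langle\xi,\nabla_W\eta\rangle_R^D$. $CC(\Xi)$ is the set of compatible connections. The curvature is $\Theta_\nabla(W,W')=\nabla_W\nabla_{W'}-\nabla_{W'}\nabla_W-\nabla_{[W,W']}$; curvature operators are identified with the elements of $E^c_{\mu\nu}$ (skew-adjoint) that induce them by the left action. The curvature is constant if all its values are scalar multiples of $\mathrm{Id}_E$. Yang–Mills functional. $\tau(\Phi)=\int_{\mathbb T^2}\Phi(x,y,0)\,dx\,dy$ on $D^c_{\mu\nu}$; the induced trace on $E^c_{\mu\nu}$ is $\tau_E(\langle\xi,\eta\rangle_L^E)=\tau(\langle\eta,\xi\rangle_R^D)$, which for $\mu>0$ is $\tau_E(\Psi)=\int_0^{2\mu}\int_0^1\Psi(x,y,0)\,dy\,dx$. $\mathrm{YM}(\nabla)=-\tau_E\big(\Theta_\nabla(X,Y)^2+\Theta_\nabla(X,Z)^2+\Theta_\nabla(Y,Z)^2\big)$. $\nabla\in CC(\Xi)$ is a critical point if the derivative of $t\mapsto\mathrm{YM}(\nabla+t\mathbb H)$ at $0$ vanishes for every linear map $\mathbb H$ from $\mathfrak h$ to the skew-adjoint elements of $E^c_{\mu\nu}$; by a known result this holds exactly when (1) $[\nabla_Y,\Theta_\nabla(X,Y)]+[\nabla_Z,\Theta_\nabla(X,Z)]=0$, (2) $[\nabla_X,\Theta_\nabla(Y,X)]+[\nabla_Z,\Theta_\nabla(Y,Z)]=0$, (3) $[\nabla_X,\Theta_\nabla(Z,X)]+[\nabla_Y,\Theta_\nabla(Z,Y)]-c\,\Theta_\nabla(X,Y)=0$.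 A minimizer is a $\nabla\in CC(\Xi)$ with $\mathrm{YM}(\nabla)\le\mathrm{YM}(\nabla')$ for all $\nabla'\in CC(\Xi)$.
   Formalization: The term μiy is not periodic in y, so ∇¹ does not map Ξ into Ξ and is not in CC(Ξ); y is read as a real coordinate on the universal cover, every other compatibility rule and the curvature are proved, and critical point and minimizer are stated without requiring ∇¹ in CC(Ξ). *)

theory Defs
  imports "HOL-Analysis.Analysis"
begin

text \<open>
  Functions on \<open>\<real> \<times> \<real>/\<int>\<close> are functions on \<open>\<real> \<times> \<real>\<close> that are 1-periodic in the second
  variable. All algebras and modules are the smooth dense versions, realised as concrete function
  spaces; sums over \<open>\<int>\<close> are unconditional sums.
\<close>

type_synonym plane_fun = "real \<Rightarrow> real \<Rightarrow> complex"
type_synonym alg_fun = "real \<Rightarrow> real \<Rightarrow> int \<Rightarrow> complex"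

definition e :: "real \<Rightarrow> complex" where
  "e t = exp (2 * of_real pi * \<i> * of_real t)"

definition dx :: "plane_fun \<Rightarrow> plane_fun" where
  "dx f = (\<lambda>x y. vector_derivative (\<lambda>s. f s y) (at x))"

definition dy :: "plane_fun \<Rightarrow> plane_fun" where
  "dy f = (\<lambda>x y. vector_derivative (\<lambda>t. f x t) (at y))"

text \<open>Iterated partial derivatives, in an arbitrary order (\<open>True\<close> stands for the \<open>x\<close>-direction).\<close>

definition iter_partial :: "bool list \<Rightarrow> plane_fun \<Rightarrow> plane_fun" where
  "iter_partial ds f = foldr (\<lambda>b. if b then dx else dy) ds f"

definition smooth :: "plane_fun \<Rightarrow> bool" where
  "smooth f \<longleftrightarrow> (\<forall>ds.
      continuous_on UNIV (\<lambda>z. iter_partial ds f (fst z) (snd z)) \<and>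
      (\<forall>x y. (\<lambda>s. iter_partial ds f s y) differentiable (at x)) \<and>
      (\<forall>x y. (\<lambda>t. iter_partial ds f x t) differentiable (at y)))"

text \<open>
  A function on \<open>\<real> \<times> \<real>/\<int> \<times> \<int>\<close> that is smooth and whose derivatives decay rapidly in \<open>p\<close>, uniformly
  for \<open>x\<close> in compact sets. This is Rieffel's description of the smooth subalgebra; the covariance
  conditions below make it enough to look at compact sets of \<open>x\<close>.
\<close>

definition smooth_rapid :: "alg_fun \<Rightarrow> bool" where
  "smooth_rapid \<Phi> \<longleftrightarrow>
     (\<forall>p. smooth (\<lambda>x y. \<Phi> x y p)) \<and>
     (\<forall>x y p. \<Phi> x (y + 1) p = \<Phi> x y p) \<and>
     (\<forall>ds n a b. \<exists>C. \<forall>x\<in>{a..b}. \<forall>y p.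
        \<bar>of_int p\<bar> ^ n * norm (iter_partial ds (\<lambda>x y. \<Phi> x y p) x y) \<le> C)"

definition D_alg :: "int \<Rightarrow> real \<Rightarrow> alg_fun set" where
  "D_alg c \<nu> = {\<Phi>. smooth_rapid \<Phi> \<and>
     (\<forall>k x y p. cnj (e (of_int (c * k * p) * (y - of_int p * \<nu>))) * \<Phi> (x + of_int k) y p = \<Phi> x y p)}"

definition E_alg :: "int \<Rightarrow> real \<Rightarrow> real \<Rightarrow> alg_fun set" where
  "E_alg c \<mu> \<nu> = {\<Psi>. smooth_rapid \<Psi> \<and>
     (\<forall>k x y p. e (of_int (c * p * k) * (y - of_int k * \<nu>)) *
        \<Psi> (x - 2 * of_int k * \<mu>) (y - 2 * of_int k * \<nu>) p = \<Psi> x y p)}"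

definition E_mult :: "alg_fun \<Rightarrow> alg_fun \<Rightarrow> alg_fun" where
  "E_mult \<Phi> \<Psi> = (\<lambda>x y p. \<Sum>\<^sub>\<infinity>q. \<Phi> x y q * \<Psi> (x + of_int q) y (p - q))"

definition E_star :: "alg_fun \<Rightarrow> alg_fun" where
  "E_star \<Psi> = (\<lambda>x y p. cnj (\<Psi> (x + of_int p) y (- p)))"

definition Id_E :: alg_fun where
  "Id_E = (\<lambda>x y p. if p = 0 then 1 else 0)"

definition E_skew :: "int \<Rightarrow> real \<Rightarrow> real \<Rightarrow> alg_fun set" where
  "E_skew c \<mu> \<nu> = {\<Psi> \<in> E_alg c \<mu> \<nu>. \<forall>x y p. E_star \<Psi> x y p = - \<Psi> x y p}"

text \<open>The smooth version of the bimodule: Schwartz functions on \<open>\<real> \<times> \<real>/\<int>\<close>.\<close>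

definition Xi :: "plane_fun set" where
  "Xi = {f. smooth f \<and> (\<forall>x y. f x (y + 1) = f x y) \<and>
     (\<forall>ds n. \<exists>C. \<forall>x y. \<bar>x\<bar> ^ n * norm (iter_partial ds f x y) \<le> C)}"

definition inner_D :: "int \<Rightarrow> real \<Rightarrow> real \<Rightarrow> plane_fun \<Rightarrow> plane_fun \<Rightarrow> alg_fun" where
  "inner_D c \<mu> \<nu> f g = (\<lambda>x y p. \<Sum>\<^sub>\<infinity>k.
     cnj (e (of_int (c * k * p) * (y - of_int p * \<nu>))) * f (x + of_int k) y *
     cnj (g (x - 2 * of_int p * \<mu> + of_int k) (y - 2 * of_int p * \<nu>)))"

definition E_act :: "alg_fun \<Rightarrow> plane_fun \<Rightarrow> plane_fun" where
  "E_act \<Psi> f = (\<lambda>x y. \<Sum>\<^sub>\<infinity>q. cnj (\<Psi> x y q) * f (x + of_int q) y)"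

definition D_act :: "real \<Rightarrow> real \<Rightarrow> plane_fun \<Rightarrow> alg_fun \<Rightarrow> plane_fun" where
  "D_act \<mu> \<nu> g \<Phi> = (\<lambda>x y. \<Sum>\<^sub>\<infinity>q.
     g (x + 2 * of_int q * \<mu>) (y + 2 * of_int q * \<nu>) *
     cnj (\<Phi> (x + 2 * of_int q * \<mu>) (y + 2 * of_int q * \<nu>) q))"

text \<open>The Heisenberg Lie algebra in coordinates with respect to the basis \<open>X\<close>, \<open>Y\<close>, \<open>Z\<close>.\<close>

type_synonym heis = "real \<times> real \<times> real"

definition hX :: heis where "hX = (1, 0, 0)"
definition hY :: heis where "hY = (0, 1, 0)"
definition hZ :: heis where "hZ = (0, 0, 1)"

definition hbracket :: "int \<Rightarrow> heis \<Rightarrow> heis \<Rightarrow> heis" where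
  "hbracket c W W' = (0, 0, of_int c * (fst W * fst (snd W') - fst (snd W) * fst W'))"

definition delta_X :: "int \<Rightarrow> real \<Rightarrow> alg_fun \<Rightarrow> alg_fun" where
  "delta_X c \<mu> \<Phi> = (\<lambda>x y p.
     2 * of_real pi * \<i> * of_int c * of_int p * of_real (x - of_int p * \<mu>) * \<Phi> x y p
     - dy (\<lambda>x y. \<Phi> x y p) x y)"

definition delta_Y :: "alg_fun \<Rightarrow> alg_fun" where
  "delta_Y \<Phi> = (\<lambda>x y p. - dx (\<lambda>x y. \<Phi> x y p) x y)"

definition delta_Z :: "alg_fun \<Rightarrow> alg_fun" where
  "delta_Z \<Phi> = (\<lambda>x y p. 2 * of_real pi * \<i> * of_int p * \<Phi> x y p)"

definition delta :: "int \<Rightarrow> real \<Rightarrow> heis \<Rightarrow> alg_fun \<Rightarrow> alg_fun" where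
  "delta c \<mu> W \<Phi> = (\<lambda>x y p.
     of_real (fst W) * delta_X c \<mu> \<Phi> x y p +
     of_real (fst (snd W)) * delta_Y \<Phi> x y p +
     of_real (snd (snd W)) * delta_Z \<Phi> x y p)"

text \<open>
  An element of \<open>Hom(\<Xi>, \<Xi> \<otimes> \<hh>\<^sup>*)\<close> is given by operators \<open>\<nabla> W\<close> depending linearly on \<open>W\<close>. They are
  modelled as maps on all functions on the plane; for a connection on \<open>\<Xi>\<close> only the restriction
  to \<^term>\<open>Xi\<close> matters.
\<close>

type_synonym conn = "heis \<Rightarrow> plane_fun \<Rightarrow> plane_fun"

text \<open>
  All the requirements on a compatible connection other than \<open>\<nabla>\<^sub>W \<Xi> \<subseteq> \<Xi>\<close>. They are kept separate
  because they also make sense when \<open>\<nabla>\<^sub>W f\<close> is a function on the plane that is not periodic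
  in \<open>y\<close>, as happens for operators whose coefficients involve the coordinate \<open>y\<close>.
\<close>

definition compatible_connection_rules :: "int \<Rightarrow> real \<Rightarrow> real \<Rightarrow> conn \<Rightarrow> bool" where
  "compatible_connection_rules c \<mu> \<nu> nab \<longleftrightarrow>
     (\<forall>f\<in>Xi. \<forall>x y. linear (\<lambda>W. nab W f x y)) \<and>
     (\<forall>W. \<forall>f\<in>Xi. \<forall>g\<in>Xi. \<forall>x y. nab W (\<lambda>x y. f x y + g x y) x y = nab W f x y + nab W g x y) \<and>
     (\<forall>W. \<forall>f\<in>Xi. \<forall>a x y. nab W (\<lambda>x y. a * f x y) x y = a * nab W f x y) \<and>
     (\<forall>W. \<forall>f\<in>Xi. \<forall>\<Phi>\<in>D_alg c \<nu>. \<forall>x y.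
        nab W (D_act \<mu> \<nu> f \<Phi>) x y
          = D_act \<mu> \<nu> (nab W f) \<Phi> x y + D_act \<mu> \<nu> f (delta c \<mu> W \<Phi>) x y) \<and>
     (\<forall>W. \<forall>f\<in>Xi. \<forall>g\<in>Xi. \<forall>x y p.
        delta c \<mu> W (inner_D c \<mu> \<nu> f g) x y p
          = inner_D c \<mu> \<nu> (nab W f) g x y p + inner_D c \<mu> \<nu> f (nab W g) x y p)"

definition CC :: "int \<Rightarrow> real \<Rightarrow> real \<Rightarrow> conn set" where
  "CC c \<mu> \<nu> = {nab. (\<forall>W. \<forall>f\<in>Xi. nab W f \<in> Xi) \<and> compatible_connection_rules c \<mu> \<nu> nab}"

definition curvature :: "int \<Rightarrow> conn \<Rightarrow> heis \<Rightarrow> heis \<Rightarrow> plane_fun \<Rightarrow> plane_fun" where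
  "curvature c nab W W' f = (\<lambda>x y.
     nab W (nab W' f) x y - nab W' (nab W f) x y - nab (hbracket c W W') f x y)"

text \<open>
  The element of \<open>E\<close> that induces a curvature operator by the left action. The action involves
  the complex conjugate of \<open>\<Theta>\<close>, so the operator of multiplication by \<open>a\<close> corresponds to the
  element \<open>cnj a\<close> times the identity.
\<close>

definition induces_curvature ::
  "int \<Rightarrow> real \<Rightarrow> real \<Rightarrow> conn \<Rightarrow> heis \<Rightarrow> heis \<Rightarrow> alg_fun \<Rightarrow> bool" where
  "induces_curvature c \<mu> \<nu> nab W W' \<Theta> \<longleftrightarrow>
     \<Theta> \<in> E_alg c \<mu> \<nu> \<and> (\<forall>f\<in>Xi. curvature c nab W W' f = E_act \<Theta> f)"

definition curvature_elem ::
  "int \<Rightarrow> real \<Rightarrow> real \<Rightarrow> conn \<Rightarrow> heis \<Rightarrow> heis \<Rightarrow> alg_fun" where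
  "curvature_elem c \<mu> \<nu> nab W W' = (THE \<Theta>. induces_curvature c \<mu> \<nu> nab W W' \<Theta>)"

text \<open>
  The trace on \<open>E\<close> induced by the trace \<open>\<Phi> \<mapsto> \<integral>\<integral> \<Phi>(x,y,0) dx dy\<close> on \<open>D\<close>. For either sign of \<open>\<mu>\<close>
  the strip of width \<open>2\<bar>\<mu>\<bar>\<close> is a fundamental domain for the translation by \<open>(2\<mu>, 2\<nu>)\<close>, under
  which \<open>\<Psi>(\<sqdot>,\<sqdot>,0)\<close> is invariant, and both traces take the value \<open>\<integral>\<integral> g * cnj f\<close> on the inner products
  of \<open>f\<close> and \<open>g\<close>.
\<close>

definition tau_E :: "real \<Rightarrow> alg_fun \<Rightarrow> complex" where
  "tau_E \<mu> \<Psi> = integral {0..2 * \<bar>\<mu>\<bar>} (\<lambda>x. integral {0..1} (\<lambda>y. \<Psi> x y 0))"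

text \<open>
  The curvature elements are skew-adjoint, so the traces below are real and taking real parts only
  changes the type.
\<close>

definition YM :: "int \<Rightarrow> real \<Rightarrow> real \<Rightarrow> conn \<Rightarrow> real" where
  "YM c \<mu> \<nu> nab =
     (let \<Theta> = curvature_elem c \<mu> \<nu> nab; sq = (\<lambda>\<Psi>. E_mult \<Psi> \<Psi>) in
      - Re (tau_E \<mu> (\<lambda>x y p.
          sq (\<Theta> hX hY) x y p + sq (\<Theta> hX hZ) x y p + sq (\<Theta> hY hZ) x y p)))"

definition skew_direction :: "int \<Rightarrow> real \<Rightarrow> real \<Rightarrow> (heis \<Rightarrow> alg_fun) \<Rightarrow> bool" where
  "skew_direction c \<mu> \<nu> H \<longleftrightarrow>
     (\<forall>W. H W \<in> E_skew c \<mu> \<nu>) \<and> (\<forall>x y p. linear (\<lambda>W. H W x y p))"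

definition perturb :: "conn \<Rightarrow> (heis \<Rightarrow> alg_fun) \<Rightarrow> real \<Rightarrow> conn" where
  "perturb nab H t = (\<lambda>W f x y. nab W f x y + of_real t * E_act (H W) f x y)"

text \<open>
  The two properties below do not include \<open>\<nabla> \<in> CC\<close>, so that negating them is not satisfied by
  non-membership; for elements of \<^term>\<open>CC c \<mu> \<nu>\<close> they are the usual notions.
\<close>

definition critical_point :: "int \<Rightarrow> real \<Rightarrow> real \<Rightarrow> conn \<Rightarrow> bool" where
  "critical_point c \<mu> \<nu> nab \<longleftrightarrow>
     (\<forall>H. skew_direction c \<mu> \<nu> H \<longrightarrow>
        ((\<lambda>t. YM c \<mu> \<nu> (perturb nab H t)) has_real_derivative 0) (at 0))"

definition minimizer :: "int \<Rightarrow> real \<Rightarrow> real \<Rightarrow> conn \<Rightarrow> bool" where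
  "minimizer c \<mu> \<nu> nab \<longleftrightarrow> (\<forall>nab'\<in>CC c \<mu> \<nu>. YM c \<mu> \<nu> nab \<le> YM c \<mu> \<nu> nab')"

end

theory Submission
  imports Defs
begin

text \<open>
  Adding \<open>\<i> s\<close> to \<open>\<nabla>\<^sub>Z\<close> leaves all commutators unchanged, because scalars are central, but the
  curvature also contains \<open>\<nabla>\<close> of the bracket \<open>[X, Y] = c Z\<close>, and this term moves. So the scalar
  curvature \<open>\<Theta>(X, Y)\<close> can be pushed towards \<open>0\<close> by a central perturbation while the other two values
  stay fixed, and a connection with \<open>\<Theta>(X, Y) \<noteq> 0\<close> scalar cannot be stationary. The coordinates in which
  this becomes a computation are the two-parameter family \<open>heis_conn c \<mu> \<nu> r s\<close>: the parameter \<open>r\<close>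
  multiplies the linear term \<open>\<mu> y - \<nu> x\<close> of \<open>\<nabla>\<^sub>X\<close>, and \<open>s\<close> is the central shift of \<open>\<nabla>\<^sub>Z\<close>. Every
  member has constant curvature, and

    \<open>YM = 2 \<bar>\<mu>\<bar> ((r \<nu> + c s)\<^sup>2 + (\<pi> / \<mu>)\<^sup>2)\<close>

  (lemma \<open>YM_heis_conn\<close>). The connection of the theorem is \<open>r = 1\<close>, \<open>s = 0\<close>. Its perturbation in the
  direction \<open>H\<^sub>Z = \<i> Id\<close> is \<open>r = 1\<close>, \<open>s = - t\<close>, so the derivative of the functional is
  \<open>- 4 \<bar>\<mu>\<bar> c \<nu> \<noteq> 0\<close>. The member \<open>r = 0\<close>, \<open>s = 0\<close> has a strictly smaller value; it lacks the term in
  the coordinate \<open>y\<close>, hence it maps \<open>\<Xi>\<close> to itself and is an honest competitor in \<open>CC\<close>.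

  Algebraically, compatibility with the module structure and the inner product only says that the
  coefficients of \<open>\<nabla>\<^sub>X\<close> and \<open>\<nabla>\<^sub>Z\<close> change by \<open>2 \<pi> \<i> c q (x + q \<mu>)\<close> and \<open>2 \<pi> \<i> q\<close> under translation by
  \<open>q (2 \<mu>, 2 \<nu>)\<close>, which are the coefficients of the derivations (\<open>X_phase_translate\<close>,
  \<open>Z_phase_translate\<close>). The linear term \<open>\<mu> y - \<nu> x\<close> is invariant under these translations, which is why
  \<open>r\<close> is free. The analytic work is of two kinds. First, module action and inner product are sums over
  \<open>\<int>\<close> that must be differentiated term by term; a calculus of growth conditions provides the summable
  majorants. Second, \<open>YM\<close> depends on the element of \<open>E\<close> that induces the curvature, so the left action
  has to be faithful (\<open>E_act_faithful\<close>); this is seen by testing on Gaussians that concentrate at a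
  single point of an orbit.
\<close>

section \<open>Differentiating sums over the integers\<close>

lemma summable_on_int_inverse_square:
  "(\<lambda>q::int. inverse ((1 + real_of_int \<bar>q\<bar>)\<^sup>2)) summable_on UNIV"
proof -
  let ?w = "\<lambda>q::int. inverse ((1 + real_of_int \<bar>q\<bar>)\<^sup>2)"
  have "summable (\<lambda>n. inverse (real n ^ 2))"
    by (rule inverse_power_summable) simp
  then have *: "summable (\<lambda>n. inverse ((1 + real n)\<^sup>2))"
    by (subst (asm) summable_Suc_iff [symmetric]) (simp add: add.commute)
  then have nat: "(\<lambda>n. inverse ((1 + real n)\<^sup>2)) summable_on UNIV"
    by (subst summable_on_UNIV_nonneg_real_iff) auto
  have 1: "?w summable_on range int"
    using nat by (subst summable_on_reindex) (auto simp: o_def)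
  have "?w summable_on range (\<lambda>n. - int n)"
    using nat by (subst summable_on_reindex) (auto simp: o_def inj_on_def)
  then have 2: "?w summable_on (range (\<lambda>n. - int n) - {0})"
    by (rule summable_on_subset_banach) auto
  have "?w summable_on (range int \<union> (range (\<lambda>n. - int n) - {0}))"
    by (rule summable_on_Un_disjoint[OF 1 2]) auto
  moreover have "range int \<union> (range (\<lambda>n. - int n) - {0}) = UNIV"
  proof -
    have "q \<in> range int \<union> (range (\<lambda>n. - int n) - {0})" for q :: int
      by (cases q rule: int_cases4) auto
    then show ?thesis by blast
  qed
  ultimately show ?thesis by simp
qed

text \<open>
  Termwise differentiation is classical for series over \<open>\<nat>\<close>; an enumeration of \<open>\<int>\<close> carries it over.
\<close>

lemma infsum_int_eq_suminf:
  fixes g :: "int \<Rightarrow> complex"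
  assumes "M summable_on UNIV" and "\<And>q. norm (g q) \<le> M q"
  shows "infsum g UNIV = (\<Sum>n. g (int_decode n))" and "summable (\<lambda>n. g (int_decode n))"
proof -
  have "(\<lambda>q. norm (g q)) summable_on UNIV"
    by (rule Infinite_Sum.abs_summable_on_comparison_test'[OF assms(1)]) (use assms in auto)
  then have s: "g summable_on UNIV" by (rule abs_summable_summable)
  have h: "((\<lambda>n. g (int_decode n)) has_sum infsum g UNIV) UNIV"
    using has_sum_infsum[OF s] has_sum_reindex_bij_betw[OF bij_int_decode, of g] by simp
  from has_sum_imp_sums[OF h] show "infsum g UNIV = (\<Sum>n. g (int_decode n))"
    and "summable (\<lambda>n. g (int_decode n))"
    by (auto simp: sums_iff)
qed

text \<open>
  The derivatives of the partial sums converge uniformly by the Weierstrass test. The majorant of the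
  terms themselves guarantees that the unconditional sum is the limit of the enumerated series at every
  point of the neighbourhood.
\<close>

lemma has_vector_derivative_infsum:
  fixes F :: "int \<Rightarrow> real \<Rightarrow> complex"
  assumes S: "open S" "convex S" "x \<in> S"
    and der: "\<And>q s. s \<in> S \<Longrightarrow> (F q has_vector_derivative F' q s) (at s)"
    and M: "M summable_on UNIV" "\<And>q s. s \<in> S \<Longrightarrow> norm (F q s) \<le> M q"
    and M': "M' summable_on UNIV" "\<And>q s. s \<in> S \<Longrightarrow> norm (F' q s) \<le> M' q"
  shows "((\<lambda>s. \<Sum>\<^sub>\<infinity>q. F q s) has_vector_derivative (\<Sum>\<^sub>\<infinity>q. F' q x)) (at x)"
proof -
  have nn: "0 \<le> M' q" for q using M'(2)[OF S(3), of q] norm_ge_zero order_trans by blast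
  have sM': "summable (\<lambda>n. M' (int_decode n))"
    using M'(1) summable_on_reindex_bij_betw[OF bij_int_decode, of M'] summable_on_imp_summable
    by blast
  let ?g' = "\<lambda>s. \<Sum>\<^sub>\<infinity>q. F' q s"
  have ul: "uniform_limit S (\<lambda>n s. \<Sum>i<n. F' (int_decode i) s) (\<lambda>s. \<Sum>i. F' (int_decode i) s) sequentially"
    by (rule Weierstrass_m_test[OF _ sM']) (use M' in auto)
  have eq': "?g' s = (\<Sum>i. F' (int_decode i) s)" if "s \<in> S" for s
    by (rule infsum_int_eq_suminf(1)[OF M'(1)]) (use M' that in auto)
  have eq: "(\<lambda>n. F (int_decode n) s) sums (\<Sum>\<^sub>\<infinity>q. F q s)" if "s \<in> S" for s
    using infsum_int_eq_suminf[OF M(1), of "\<lambda>q. F q s"] M that by (simp add: sums_iff)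
  have "\<exists>g. \<forall>s\<in>S. (\<lambda>n. F (int_decode n) s) sums (g s) \<and>
      (g has_derivative (\<lambda>h. h *\<^sub>R ?g' s)) (at s within S)"
  proof (rule has_derivative_series[where x = x and f = "\<lambda>n. F (int_decode n)" and g' = "\<lambda>s h. h *\<^sub>R ?g' s" and f' = "\<lambda>n s h. h *\<^sub>R F' (int_decode n) s", OF S(2) _ _ S(3) eq[OF S(3)]])
    fix n s assume "s \<in> S"
    then show "(F (int_decode n) has_derivative (\<lambda>h. h *\<^sub>R F' (int_decode n) s)) (at s within S)"
      using der[of s "int_decode n"] has_derivative_at_withinI
      by (auto simp: has_vector_derivative_def)
  next
    fix d :: real assume "d > 0"
    from uniform_limitD[OF ul this]
    show "\<forall>\<^sub>F n in sequentially. \<forall>s\<in>S. \<forall>h. norm ((\<Sum>i<n. h *\<^sub>R F' (int_decode i) s) - h *\<^sub>R ?g' s) \<le> d * norm h"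
    proof eventually_elim
      case (elim n)
      show ?case
      proof (intro ballI allI)
        fix s h assume s: "s \<in> S"
        have "(\<Sum>i<n. h *\<^sub>R F' (int_decode i) s) - h *\<^sub>R ?g' s
            = h *\<^sub>R ((\<Sum>i<n. F' (int_decode i) s) - (\<Sum>i. F' (int_decode i) s))"
          by (simp add: eq'[OF s] scaleR_sum_right scaleR_diff_right)
        then show "norm ((\<Sum>i<n. h *\<^sub>R F' (int_decode i) s) - h *\<^sub>R ?g' s) \<le> d * norm h"
          using mult_left_mono[OF less_imp_le[OF bspec[OF elim s]], of "\<bar>h\<bar>"]
          by (simp add: dist_norm mult.commute)
      qed
    qed
  qed
  then obtain g where g: "\<And>s. s \<in> S \<Longrightarrow> (\<lambda>n. F (int_decode n) s) sums (g s)"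
      "\<And>s. s \<in> S \<Longrightarrow> (g has_derivative (\<lambda>h. h *\<^sub>R ?g' s)) (at s within S)" by blast
  have eqg: "g s = (\<Sum>\<^sub>\<infinity>q. F q s)" if "s \<in> S" for s
    using g(1)[OF that] eq[OF that] sums_unique2 by blast
  have "(g has_vector_derivative ?g' x) (at x)"
    using g(2)[OF S(3)] at_within_open[OF S(3) S(1)] by (simp add: has_vector_derivative_def)
  then show ?thesis
    by (rule has_vector_derivative_transform_within_open[OF _ S(1,3) eqg])
qed

text \<open>
  Majorants uniform on squares allow one and the same property to serve for differentiation in \<open>x\<close> and
  in \<open>y\<close> and for summability at a point.
\<close>

definition locally_dominated :: "(int \<Rightarrow> plane_fun) \<Rightarrow> bool" where
  "locally_dominated F \<longleftrightarrow> (\<forall>R. \<exists>M. M summable_on UNIV \<and>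
     (\<forall>q x y. \<bar>x\<bar> \<le> R \<longrightarrow> \<bar>y\<bar> \<le> R \<longrightarrow> norm (F q x y) \<le> M q))"

lemma locally_dominatedE:
  assumes "locally_dominated F"
  obtains M where "M summable_on UNIV"
    "\<And>q x y. \<bar>x\<bar> \<le> R \<Longrightarrow> \<bar>y\<bar> \<le> R \<Longrightarrow> norm (F q x y) \<le> M q"
  using assms unfolding locally_dominated_def by blast

lemma locally_dominated_add:
  assumes "locally_dominated F" "locally_dominated G"
  shows "locally_dominated (\<lambda>q x y. F q x y + G q x y)"
  unfolding locally_dominated_def
proof
  fix R
  obtain M where "M summable_on UNIV"
    "\<And>q x y. \<bar>x\<bar> \<le> R \<Longrightarrow> \<bar>y\<bar> \<le> R \<Longrightarrow> norm (F q x y) \<le> M q"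
    using locally_dominatedE[OF assms(1)] by blast
  moreover obtain N where "N summable_on UNIV"
    "\<And>q x y. \<bar>x\<bar> \<le> R \<Longrightarrow> \<bar>y\<bar> \<le> R \<Longrightarrow> norm (G q x y) \<le> N q"
    using locally_dominatedE[OF assms(2)] by blast
  ultimately show "\<exists>M. M summable_on UNIV \<and>
     (\<forall>q x y. \<bar>x\<bar> \<le> R \<longrightarrow> \<bar>y\<bar> \<le> R \<longrightarrow> norm (F q x y + G q x y) \<le> M q)"
    by (intro exI[of _ "\<lambda>q. M q + N q"])
       (auto intro!: summable_on_add norm_triangle_le add_mono)
qed

lemma locally_dominated_summable:
  assumes "locally_dominated F"
  shows "(\<lambda>q. F q x y) summable_on UNIV"
proof -
  obtain M where "M summable_on UNIV"
    and "\<And>q a b. \<bar>a\<bar> \<le> max \<bar>x\<bar> \<bar>y\<bar> \<Longrightarrow> \<bar>b\<bar> \<le> max \<bar>x\<bar> \<bar>y\<bar> \<Longrightarrow> norm (F q a b) \<le> M q"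
    using locally_dominatedE[OF assms] by blast
  then have "(\<lambda>q. norm (F q x y)) summable_on UNIV"
    by (intro Infinite_Sum.abs_summable_on_comparison_test'[of M]) auto
  then show ?thesis by (rule abs_summable_summable)
qed

lemma dx_infsum:
  assumes "locally_dominated F" "locally_dominated F'"
    and der: "\<And>q x y. ((\<lambda>s. F q s y) has_vector_derivative F' q x y) (at x)"
  shows "dx (\<lambda>x y. \<Sum>\<^sub>\<infinity>q. F q x y) x y = (\<Sum>\<^sub>\<infinity>q. F' q x y)"
proof -
  define R where "R = max (\<bar>x\<bar> + 1) \<bar>y\<bar>"
  obtain M where M: "M summable_on UNIV"
    "\<And>q a b. \<bar>a\<bar> \<le> R \<Longrightarrow> \<bar>b\<bar> \<le> R \<Longrightarrow> norm (F q a b) \<le> M q"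
    using locally_dominatedE[OF assms(1)] by blast
  obtain M' where M': "M' summable_on UNIV"
    "\<And>q a b. \<bar>a\<bar> \<le> R \<Longrightarrow> \<bar>b\<bar> \<le> R \<Longrightarrow> norm (F' q a b) \<le> M' q"
    using locally_dominatedE[OF assms(2)] by blast
  have "((\<lambda>s. \<Sum>\<^sub>\<infinity>q. F q s y) has_vector_derivative (\<Sum>\<^sub>\<infinity>q. F' q x y)) (at x)"
    by (rule has_vector_derivative_infsum[where S = "{x-1<..<x+1}" and M = M and M' = M'])
       (auto intro!: der M M' simp: R_def)
  then show ?thesis unfolding dx_def by (rule vector_derivative_at)
qed

lemma dy_infsum:
  assumes "locally_dominated F" "locally_dominated F'"
    and der: "\<And>q x y. ((\<lambda>t. F q x t) has_vector_derivative F' q x y) (at y)"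
  shows "dy (\<lambda>x y. \<Sum>\<^sub>\<infinity>q. F q x y) x y = (\<Sum>\<^sub>\<infinity>q. F' q x y)"
proof -
  define R where "R = max (\<bar>y\<bar> + 1) \<bar>x\<bar>"
  obtain M where M: "M summable_on UNIV"
    "\<And>q a b. \<bar>a\<bar> \<le> R \<Longrightarrow> \<bar>b\<bar> \<le> R \<Longrightarrow> norm (F q a b) \<le> M q"
    using locally_dominatedE[OF assms(1)] by blast
  obtain M' where M': "M' summable_on UNIV"
    "\<And>q a b. \<bar>a\<bar> \<le> R \<Longrightarrow> \<bar>b\<bar> \<le> R \<Longrightarrow> norm (F' q a b) \<le> M' q"
    using locally_dominatedE[OF assms(2)] by blast
  have "((\<lambda>t. \<Sum>\<^sub>\<infinity>q. F q x t) has_vector_derivative (\<Sum>\<^sub>\<infinity>q. F' q x y)) (at y)"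
    by (rule has_vector_derivative_infsum[where S = "{y-1<..<y+1}" and M = M and M' = M'])
       (auto intro!: der M M' simp: R_def)
  then show ?thesis unfolding dy_def by (rule vector_derivative_at)
qed

section \<open>Growth conditions\<close>

text \<open>
  The products occurring below have a factor evaluated along an arithmetic progression of points and a
  factor that depends on the summation index directly. The first factor decays rapidly in \<open>x\<close>. It may
  grow polynomially in \<open>y\<close>, since connections may multiply by the coordinate \<open>y\<close>. The degree \<open>m\<close> of this
  growth is chosen before the decay exponent \<open>n\<close>: along the progression \<open>y\<close> grows linearly in the
  index, and the growth can only be absorbed by decay if its degree does not depend on \<open>n\<close>.
\<close>

definition rapid :: "plane_fun \<Rightarrow> bool" where
  "rapid h \<longleftrightarrow> (\<exists>m. \<forall>n. \<exists>C. \<forall>x y. \<bar>x\<bar> ^ n * norm (h x y) \<le> C * (1 + \<bar>y\<bar>) ^ m)"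

text \<open>
  Polynomial growth of the second factor in the index, of any degree, is harmless next to rapid decay.
  Local uniformity in the plane suffices, because the sums are only differentiated at points.
\<close>

definition moderate :: "(int \<Rightarrow> plane_fun) \<Rightarrow> bool" where
  "moderate B \<longleftrightarrow> (\<forall>R. \<exists>K m. \<forall>q x y. \<bar>x\<bar> \<le> R \<longrightarrow> \<bar>y\<bar> \<le> R \<longrightarrow>
     norm (B q x y) \<le> K * (1 + real_of_int \<bar>q\<bar>) ^ m)"

lemma moderateE:
  assumes "moderate B"
  obtains K m where "\<And>q x y. \<bar>x\<bar> \<le> R \<Longrightarrow> \<bar>y\<bar> \<le> R \<Longrightarrow>
     norm (B q x y) \<le> K * (1 + real_of_int \<bar>q\<bar>) ^ m"
  using assms unfolding moderate_def by blast

lemma poly_bound_add: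
  fixes A B C D :: real
  assumes "A \<le> C * (1 + t) ^ m" "B \<le> D * (1 + t) ^ n" "t \<ge> 0"
  shows "A + B \<le> (\<bar>C\<bar> + \<bar>D\<bar>) * (1 + t) ^ (m + n)"
proof -
  have "C * (1 + t) ^ m \<le> \<bar>C\<bar> * (1 + t) ^ (m + n)" "D * (1 + t) ^ n \<le> \<bar>D\<bar> * (1 + t) ^ (m + n)"
    using assms(3) by (auto intro!: mult_mono power_increasing)
  then show ?thesis using assms by (simp add: ring_distribs)
qed

lemma poly_bound_mult:
  fixes A B C D :: real
  assumes "A \<le> C * (1 + t) ^ m" "B \<le> D * (1 + t) ^ n" "t \<ge> 0" "0 \<le> A" "0 \<le> B"
  shows "A * B \<le> C * D * (1 + t) ^ (m + n)"
  using mult_mono'[OF assms(1,2)] assms by (simp add: power_add mult_ac)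

lemma moderate_add:
  assumes "moderate A" "moderate B"
  shows "moderate (\<lambda>q x y. A q x y + B q x y)"
  unfolding moderate_def
proof
  fix R
  obtain C m where
    "\<And>q x y. \<bar>x\<bar> \<le> R \<Longrightarrow> \<bar>y\<bar> \<le> R \<Longrightarrow> norm (A q x y) \<le> C * (1 + real_of_int \<bar>q\<bar>) ^ m"
    using moderateE[OF assms(1)] by blast
  moreover obtain D n where
    "\<And>q x y. \<bar>x\<bar> \<le> R \<Longrightarrow> \<bar>y\<bar> \<le> R \<Longrightarrow> norm (B q x y) \<le> D * (1 + real_of_int \<bar>q\<bar>) ^ n"
    using moderateE[OF assms(2)] by blast
  ultimately have "norm (A q x y + B q x y) \<le> (\<bar>C\<bar> + \<bar>D\<bar>) * (1 + real_of_int \<bar>q\<bar>) ^ (m + n)"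
    if "\<bar>x\<bar> \<le> R" "\<bar>y\<bar> \<le> R" for q x y
    using that by (intro order_trans[OF norm_triangle_ineq] poly_bound_add) auto
  then show "\<exists>K m. \<forall>q x y. \<bar>x\<bar> \<le> R \<longrightarrow> \<bar>y\<bar> \<le> R \<longrightarrow>
     norm (A q x y + B q x y) \<le> K * (1 + real_of_int \<bar>q\<bar>) ^ m" by blast
qed

lemma moderate_mult:
  assumes "moderate A" "moderate B"
  shows "moderate (\<lambda>q x y. A q x y * B q x y)"
  unfolding moderate_def
proof
  fix R
  obtain C m where
    "\<And>q x y. \<bar>x\<bar> \<le> R \<Longrightarrow> \<bar>y\<bar> \<le> R \<Longrightarrow> norm (A q x y) \<le> C * (1 + real_of_int \<bar>q\<bar>) ^ m"
    using moderateE[OF assms(1)] by blast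
  moreover obtain D n where
    "\<And>q x y. \<bar>x\<bar> \<le> R \<Longrightarrow> \<bar>y\<bar> \<le> R \<Longrightarrow> norm (B q x y) \<le> D * (1 + real_of_int \<bar>q\<bar>) ^ n"
    using moderateE[OF assms(2)] by blast
  ultimately have "norm (A q x y * B q x y) \<le> C * D * (1 + real_of_int \<bar>q\<bar>) ^ (m + n)"
    if "\<bar>x\<bar> \<le> R" "\<bar>y\<bar> \<le> R" for q x y
    using that unfolding norm_mult by (intro poly_bound_mult) auto
  then show "\<exists>K m. \<forall>q x y. \<bar>x\<bar> \<le> R \<longrightarrow> \<bar>y\<bar> \<le> R \<longrightarrow>
     norm (A q x y * B q x y) \<le> K * (1 + real_of_int \<bar>q\<bar>) ^ m" by blast
qed

lemma moderate_norm_le: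
  assumes "moderate A" "\<And>q x y. norm (B q x y) \<le> norm (A q x y)"
  shows "moderate B"
  unfolding moderate_def
proof
  fix R
  obtain K m where "\<And>q x y. \<bar>x\<bar> \<le> R \<Longrightarrow> \<bar>y\<bar> \<le> R \<Longrightarrow>
      norm (A q x y) \<le> K * (1 + real_of_int \<bar>q\<bar>) ^ m"
    using moderateE[OF assms(1), of R] by blast
  then show "\<exists>K m. \<forall>q x y. \<bar>x\<bar> \<le> R \<longrightarrow> \<bar>y\<bar> \<le> R \<longrightarrow>
      norm (B q x y) \<le> K * (1 + real_of_int \<bar>q\<bar>) ^ m"
    using order_trans[OF assms(2)] by blast
qed

lemma moderate_cnj: "moderate A \<Longrightarrow> moderate (\<lambda>q x y. cnj (A q x y))"
  by (erule moderate_norm_le) simp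

lemma moderate_plane:
  assumes "\<And>R. \<exists>K. \<forall>x y. \<bar>x\<bar> \<le> R \<longrightarrow> \<bar>y\<bar> \<le> R \<longrightarrow> norm (f x y) \<le> K"
  shows "moderate (\<lambda>q. f)"
  unfolding moderate_def
proof
  fix R
  from assms obtain K where "\<forall>x y. \<bar>x\<bar> \<le> R \<longrightarrow> \<bar>y\<bar> \<le> R \<longrightarrow> norm (f x y) \<le> K" by blast
  then show "\<exists>K m. \<forall>q x y. \<bar>x\<bar> \<le> R \<longrightarrow> \<bar>y\<bar> \<le> R \<longrightarrow>
     norm (f x y) \<le> K * (1 + real_of_int \<bar>q\<bar>) ^ m"
    by (intro exI[of _ K] exI[of _ 0]) auto
qed

lemma moderate_const: "moderate (\<lambda>q x y. a)"
  by (rule moderate_plane) auto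

lemma moderate_x: "moderate (\<lambda>q x y. of_real x)"
  by (rule moderate_plane) auto

lemma moderate_y: "moderate (\<lambda>q x y. of_real y)"
  by (rule moderate_plane) auto

lemma moderate_q: "moderate (\<lambda>q x y. of_int q)"
  unfolding moderate_def
  by (intro allI exI[of _ 1]) auto

lemmas moderate_intros =
  moderate_add moderate_mult moderate_cnj moderate_const moderate_x moderate_y moderate_q

lemma rapid_add:
  assumes "rapid f" "rapid g"
  shows "rapid (\<lambda>x y. f x y + g x y)"
proof -
  obtain m where f: "\<And>n. \<exists>C. \<forall>x y. \<bar>x\<bar> ^ n * norm (f x y) \<le> C * (1 + \<bar>y\<bar>) ^ m"
    using assms(1) unfolding rapid_def by blast
  obtain k where g: "\<And>n. \<exists>C. \<forall>x y. \<bar>x\<bar> ^ n * norm (g x y) \<le> C * (1 + \<bar>y\<bar>) ^ k"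
    using assms(2) unfolding rapid_def by blast
  have "\<exists>C. \<forall>x y. \<bar>x\<bar> ^ n * norm (f x y + g x y) \<le> C * (1 + \<bar>y\<bar>) ^ (m + k)" for n
  proof -
    obtain C D where "\<And>x y. \<bar>x\<bar> ^ n * norm (f x y) \<le> C * (1 + \<bar>y\<bar>) ^ m"
      "\<And>x y. \<bar>x\<bar> ^ n * norm (g x y) \<le> D * (1 + \<bar>y\<bar>) ^ k"
      using f[of n] g[of n] by blast
    then have *: "\<bar>x\<bar> ^ n * norm (f x y) + \<bar>x\<bar> ^ n * norm (g x y) \<le> (\<bar>C\<bar> + \<bar>D\<bar>) * (1 + \<bar>y\<bar>) ^ (m + k)"
      for x y by (intro poly_bound_add) auto
    have "\<bar>x\<bar> ^ n * norm (f x y + g x y) \<le> \<bar>x\<bar> ^ n * (norm (f x y) + norm (g x y))" for x y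
      by (intro mult_left_mono norm_triangle_ineq) auto
    with * show ?thesis
      by (intro exI[of _ "\<bar>C\<bar> + \<bar>D\<bar>"] allI) (simp only: distrib_left, rule order_trans)
  qed
  then show ?thesis unfolding rapid_def by blast
qed

lemma rapid_mult_bounded:
  assumes "rapid f" "\<And>x y. norm (g x y) \<le> D * (1 + \<bar>y\<bar>) ^ k"
  shows "rapid (\<lambda>x y. g x y * f x y)"
proof -
  obtain m where f: "\<And>n. \<exists>C. \<forall>x y. \<bar>x\<bar> ^ n * norm (f x y) \<le> C * (1 + \<bar>y\<bar>) ^ m"
    using assms unfolding rapid_def by blast
  have "\<exists>C. \<forall>x y. \<bar>x\<bar> ^ n * norm (g x y * f x y) \<le> C * (1 + \<bar>y\<bar>) ^ (m + k)" for n
  proof -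
    obtain C where "\<And>x y. \<bar>x\<bar> ^ n * norm (f x y) \<le> C * (1 + \<bar>y\<bar>) ^ m"
      using f[of n] by blast
    then have "(\<bar>x\<bar> ^ n * norm (f x y)) * norm (g x y) \<le> C * D * (1 + \<bar>y\<bar>) ^ (m + k)" for x y
      by (rule poly_bound_mult[OF _ assms(2)]) auto
    then show ?thesis
      by (intro exI[of _ "C * D"]) (simp add: norm_mult mult_ac)
  qed
  then show ?thesis unfolding rapid_def by blast
qed

lemma rapid_cmult: "rapid f \<Longrightarrow> rapid (\<lambda>x y. a * f x y)"
  by (rule rapid_mult_bounded[where D = "norm a" and k = 0]) auto

lemma rapid_ymult: "rapid f \<Longrightarrow> rapid (\<lambda>x y. of_real y * f x y)"
  by (rule rapid_mult_bounded[where D = 1 and k = 1]) auto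

lemma rapid_xmult:
  assumes "rapid f" shows "rapid (\<lambda>x y. of_real x * f x y)"
proof -
  obtain m where f: "\<And>n. \<exists>C. \<forall>x y. \<bar>x\<bar> ^ n * norm (f x y) \<le> C * (1 + \<bar>y\<bar>) ^ m"
    using assms unfolding rapid_def by blast
  have "\<exists>C. \<forall>x y. \<bar>x\<bar> ^ n * norm (of_real x * f x y) \<le> C * (1 + \<bar>y\<bar>) ^ m" for n
    using f[of "Suc n"] by (simp add: norm_mult mult_ac)
  then show ?thesis unfolding rapid_def by blast
qed

lemma rapid_mult_translate:
  assumes "rapid f" "rapid g"
  shows "rapid (\<lambda>x y. f x y * cnj (g (x - a) (y - b)))"
proof -
  obtain C m where C: "\<And>x y. norm (g x y) \<le> C * (1 + \<bar>y\<bar>) ^ m"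
  proof -
    obtain m where "\<And>n. \<exists>C. \<forall>x y. \<bar>x\<bar> ^ n * norm (g x y) \<le> C * (1 + \<bar>y\<bar>) ^ m"
      using assms(2) unfolding rapid_def by blast
    from this[of 0] show ?thesis using that by auto
  qed
  have "0 \<le> C" using C[of 0 0] by (auto intro: order_trans[OF norm_ge_zero])
  have "norm (cnj (g (x - a) (y - b))) \<le> (C * (1 + \<bar>b\<bar>) ^ m) * (1 + \<bar>y\<bar>) ^ m" for x y
  proof -
    have "0 \<le> \<bar>b\<bar> * \<bar>y\<bar>" by simp
    then have "1 + \<bar>y - b\<bar> \<le> (1 + \<bar>b\<bar>) * (1 + \<bar>y\<bar>)"
      using abs_triangle_ineq4[of y b] unfolding ring_distribs by linarith
    then have "(1 + \<bar>y - b\<bar>) ^ m \<le> ((1 + \<bar>b\<bar>) * (1 + \<bar>y\<bar>)) ^ m"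
      by (intro power_mono) auto
    then have "C * (1 + \<bar>y - b\<bar>) ^ m \<le> C * ((1 + \<bar>b\<bar>) * (1 + \<bar>y\<bar>)) ^ m"
      using \<open>0 \<le> C\<close> by (rule mult_left_mono)
    with C[of "x - a" "y - b"] show ?thesis
      by (simp add: power_mult_distrib mult.assoc)
  qed
  from rapid_mult_bounded[OF assms(1) this] show ?thesis by (simp add: mult.commute)
qed

lemma rapid_power_bound:
  assumes "rapid h"
  shows "\<exists>m. \<forall>n. \<exists>C. \<forall>x y. (1 + \<bar>x\<bar>) ^ n * norm (h x y) \<le> C * (1 + \<bar>y\<bar>) ^ m"
proof -
  obtain m where h: "\<And>n. \<exists>C. \<forall>x y. \<bar>x\<bar> ^ n * norm (h x y) \<le> C * (1 + \<bar>y\<bar>) ^ m"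
    using assms unfolding rapid_def by blast
  have "\<exists>C. \<forall>x y. (1 + \<bar>x\<bar>) ^ n * norm (h x y) \<le> C * (1 + \<bar>y\<bar>) ^ m" for n
  proof -
    obtain C0 Cn where
      0: "\<And>x y. \<bar>x\<bar> ^ 0 * norm (h x y) \<le> C0 * (1 + \<bar>y\<bar>) ^ m" and
      n: "\<And>x y. \<bar>x\<bar> ^ n * norm (h x y) \<le> Cn * (1 + \<bar>y\<bar>) ^ m"
      using h[of 0] h[of n] by blast
    have "(1 + \<bar>x\<bar>) ^ n * norm (h x y) \<le> (2 ^ n * (C0 + Cn)) * (1 + \<bar>y\<bar>) ^ m" for x y
    proof -
      have "(1 + \<bar>x\<bar>) ^ n \<le> (2 * max 1 \<bar>x\<bar>) ^ n" by (intro power_mono) auto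
      also have "\<dots> \<le> 2 ^ n * (\<bar>x\<bar> ^ 0 + \<bar>x\<bar> ^ n)"
        by (auto simp: power_mult_distrib max_def)
      finally have "(1 + \<bar>x\<bar>) ^ n * norm (h x y) \<le> 2 ^ n * (\<bar>x\<bar> ^ 0 + \<bar>x\<bar> ^ n) * norm (h x y)"
        by (rule mult_right_mono) simp
      also have "\<dots> = 2 ^ n * (\<bar>x\<bar> ^ 0 * norm (h x y) + \<bar>x\<bar> ^ n * norm (h x y))"
        by (simp add: algebra_simps)
      also have "\<dots> \<le> 2 ^ n * (C0 * (1 + \<bar>y\<bar>) ^ m + Cn * (1 + \<bar>y\<bar>) ^ m)"
        by (intro mult_left_mono add_mono 0 n) auto
      finally show ?thesis by (simp add: algebra_simps)
    qed
    then show ?thesis by blast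
  qed
  then show ?thesis by blast
qed

text \<open>
  Along the progression \<open>x + q l\<close> with \<open>l \<noteq> 0\<close> the size of \<open>q\<close> is controlled by the size of the first
  coordinate, so decay in \<open>x\<close> is decay in \<open>q\<close>. The second coordinate grows at most linearly in \<open>q\<close>,
  which costs \<open>m\<close> of the \<open>n + m\<close> powers that are available.
\<close>

lemma rapid_lattice_bound:
  assumes "rapid h" "l \<noteq> 0"
  shows "\<exists>C. \<forall>q x y. \<bar>x\<bar> \<le> R \<longrightarrow> \<bar>y\<bar> \<le> R \<longrightarrow>
     (1 + real_of_int \<bar>q\<bar>) ^ n * norm (h (x + of_int q * l) (y + of_int q * k)) \<le> C"
proof (cases "0 \<le> R")
  case True
  obtain m where "\<And>n. \<exists>C. \<forall>x y. (1 + \<bar>x\<bar>) ^ n * norm (h x y) \<le> C * (1 + \<bar>y\<bar>) ^ m"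
    using rapid_power_bound[OF assms(1)] by blast
  then obtain C where C: "\<And>x y. (1 + \<bar>x\<bar>) ^ (n + m) * norm (h x y) \<le> C * (1 + \<bar>y\<bar>) ^ m" by blast
  have "0 \<le> C" using C[of 0 0] by (auto intro: order_trans[OF norm_ge_zero])
  define a where "a = 1 + (1 + R) / \<bar>l\<bar>"
  define b where "b = 1 + R + \<bar>k\<bar>"
  have "(1 + real_of_int \<bar>q\<bar>) ^ n * norm (h (x + of_int q * l) (y + of_int q * k)) \<le> a ^ (n + m) * C * b ^ m"
    if R: "\<bar>x\<bar> \<le> R" "\<bar>y\<bar> \<le> R" for q x y
  proof -
    define u where "u = x + of_int q * l"
    define v where "v = y + of_int q * k"
    define w where "w = 1 + real_of_int \<bar>q\<bar>"
    have w: "w > 0" "w \<ge> 1" by (auto simp: w_def)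
    have "real_of_int \<bar>q\<bar> * \<bar>l\<bar> \<le> \<bar>u\<bar> + R"
      using R abs_triangle_ineq4[of u x] by (simp add: u_def abs_mult)
    then have "real_of_int \<bar>q\<bar> \<le> (\<bar>u\<bar> + R) / \<bar>l\<bar>"
      using assms(2) by (simp add: pos_le_divide_eq)
    moreover have "(\<bar>u\<bar> + R) / \<bar>l\<bar> \<le> (1 + R) / \<bar>l\<bar> * (1 + \<bar>u\<bar>)"
    proof -
      have "\<bar>u\<bar> + R \<le> (1 + R) * (1 + \<bar>u\<bar>)" using True mult_nonneg_nonneg[OF True abs_ge_zero[of u]]
        unfolding ring_distribs by linarith
      then show ?thesis by (simp add: divide_right_mono)
    qed
    ultimately have wu: "w \<le> a * (1 + \<bar>u\<bar>)"
      unfolding w_def a_def ring_distribs by linarith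
    have vb: "1 + \<bar>v\<bar> \<le> b * w"
    proof -
      have "\<bar>v\<bar> \<le> R + \<bar>k\<bar> * real_of_int \<bar>q\<bar>"
        using abs_triangle_ineq[of y "of_int q * k"] R unfolding v_def by (simp add: abs_mult mult.commute)
      moreover have "0 \<le> R * real_of_int \<bar>q\<bar>" using True by simp
      moreover have "0 \<le> \<bar>k\<bar>" "0 \<le> real_of_int \<bar>q\<bar>" by simp_all
      ultimately show ?thesis unfolding b_def w_def ring_distribs by linarith
    qed
    (* Both sides carry the factor w ^ m that the growth in y costs; it is cancelled at the end. *)
    have "w ^ m * (w ^ n * norm (h u v)) = w ^ (n + m) * norm (h u v)" by (simp add: power_add)
    also have "\<dots> \<le> (a * (1 + \<bar>u\<bar>)) ^ (n + m) * norm (h u v)"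
      using wu w by (intro mult_right_mono power_mono) auto
    also have "\<dots> = a ^ (n + m) * ((1 + \<bar>u\<bar>) ^ (n + m) * norm (h u v))"
      by (simp add: power_mult_distrib)
    also have "\<dots> \<le> a ^ (n + m) * (C * (b * w) ^ m)"
    proof (intro mult_left_mono)
      have "C * (1 + \<bar>v\<bar>) ^ m \<le> C * (b * w) ^ m"
        using \<open>0 \<le> C\<close> vb by (intro mult_left_mono power_mono) auto
      with C[of u v] show "(1 + \<bar>u\<bar>) ^ (n + m) * norm (h u v) \<le> C * (b * w) ^ m" by linarith
    qed (use True in \<open>auto simp: a_def\<close>)
    also have "\<dots> = w ^ m * (a ^ (n + m) * C * b ^ m)" by (simp add: power_mult_distrib)
    finally show ?thesis using w unfolding u_def v_def w_def by simp
  qed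
  then show ?thesis by blast
next
  case False
  then have "\<not> \<bar>x\<bar> \<le> R" for x :: real by simp
  then show ?thesis by simp
qed

text \<open>
  The source of all majorants below: two powers more than the growth of the moderate factor are spent
  on the summable sequence \<open>1 / (1 + \<bar>q\<bar>)\<^sup>2\<close>.
\<close>

lemma locally_dominated_moderate_rapid:
  assumes "moderate B" "rapid h" "l \<noteq> 0"
  shows "locally_dominated (\<lambda>q x y. B q x y * h (x + of_int q * l) (y + of_int q * k))"
  unfolding locally_dominated_def
proof
  fix R
  obtain K m where K: "\<And>q x y. \<bar>x\<bar> \<le> R \<Longrightarrow> \<bar>y\<bar> \<le> R \<Longrightarrow> norm (B q x y) \<le> K * (1 + real_of_int \<bar>q\<bar>) ^ m"
    using moderateE[OF assms(1)] by blast
  obtain C where C: "\<And>q x y. \<bar>x\<bar> \<le> R \<Longrightarrow> \<bar>y\<bar> \<le> R \<Longrightarrow>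
     (1 + real_of_int \<bar>q\<bar>) ^ (m + 2) * norm (h (x + of_int q * l) (y + of_int q * k)) \<le> C"
    using rapid_lattice_bound[OF assms(2,3), of R "m + 2" k] by blast
  show "\<exists>M. M summable_on UNIV \<and> (\<forall>q x y. \<bar>x\<bar> \<le> R \<longrightarrow> \<bar>y\<bar> \<le> R \<longrightarrow>
     norm (B q x y * h (x + of_int q * l) (y + of_int q * k)) \<le> M q)"
  proof (intro exI conjI allI impI)
    show "(\<lambda>q. \<bar>K\<bar> * C * inverse ((1 + real_of_int \<bar>q\<bar>)\<^sup>2)) summable_on UNIV"
      by (intro summable_on_cmult_right summable_on_int_inverse_square)
    fix q :: int and x y assume R: "\<bar>x\<bar> \<le> R" "\<bar>y\<bar> \<le> R"
    define w where "w = 1 + real_of_int \<bar>q\<bar>"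
    have w: "w > 0" by (simp add: w_def)
    let ?h = "norm (h (x + of_int q * l) (y + of_int q * k))"
    have "norm (B q x y) \<le> \<bar>K\<bar> * w ^ m"
      using K[OF R, of q] w unfolding w_def [symmetric]
      by (smt (verit) mult_right_mono abs_ge_self zero_le_power)
    then have "norm (B q x y) * ?h \<le> \<bar>K\<bar> * w ^ m * ?h" by (rule mult_right_mono) simp
    also have "\<dots> = \<bar>K\<bar> * (w ^ (m + 2) * ?h) * inverse (w\<^sup>2)"
      using w by (simp add: power_add field_simps power2_eq_square)
    also have "\<dots> \<le> \<bar>K\<bar> * C * inverse (w\<^sup>2)"
      using C[OF R, of q] by (intro mult_right_mono mult_left_mono) (auto simp: w_def)
    finally show "norm (B q x y * h (x + of_int q * l) (y + of_int q * k)) \<le> \<bar>K\<bar> * C * inverse ((1 + real_of_int \<bar>q\<bar>)\<^sup>2)"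
      unfolding w_def by (simp add: norm_mult)
  qed
qed

section \<open>Schwartz functions on the cylinder\<close>

lemma iter_partial_Nil [simp]: "iter_partial [] f = f"
  by (simp add: iter_partial_def)

lemma iter_partial_Cons:
  "iter_partial (b # ds) f = (if b then dx else dy) (iter_partial ds f)"
  by (simp add: iter_partial_def)

lemma iter_partial_append: "iter_partial (ds @ es) f = iter_partial ds (iter_partial es f)"
  by (simp add: iter_partial_def)

lemma iter_partial_partial:
  "iter_partial ds (dx f) = iter_partial (ds @ [True]) f"
  "iter_partial ds (dy f) = iter_partial (ds @ [False]) f"
  by (simp_all add: iter_partial_append iter_partial_Cons)

lemma smooth_partial: "smooth f \<Longrightarrow> smooth (dx f)" "smooth f \<Longrightarrow> smooth (dy f)"
  unfolding smooth_def iter_partial_partial by blast+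

lemma smoothD:
  assumes "smooth f"
  shows "continuous_on UNIV (\<lambda>z. f (fst z) (snd z))"
    and "((\<lambda>s. f s y) has_vector_derivative dx f x y) (at x)"
    and "((\<lambda>t. f x t) has_vector_derivative dy f x y) (at y)"
  using assms[unfolded smooth_def, rule_format, of "[]"]
  by (simp_all add: dx_def dy_def vector_derivative_works)

lemma periodic_partial:
  assumes "\<And>x y. f x (y + 1) = f x y"
  shows "dx f x (y + 1) = dx f x y"
    and "((\<lambda>t. f x t) has_vector_derivative dy f x y) (at y) \<Longrightarrow>
         ((\<lambda>t. f x t) has_vector_derivative dy f x (y + 1)) (at (y + 1)) \<Longrightarrow> dy f x (y + 1) = dy f x y"
proof -
  show "dx f x (y + 1) = dx f x y" by (simp add: dx_def assms)
  assume 1: "((\<lambda>t. f x t) has_vector_derivative dy f x y) (at y)"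
    and 2: "((\<lambda>t. f x t) has_vector_derivative dy f x (y + 1)) (at (y + 1))"
  have "((\<lambda>t. t + 1) has_vector_derivative 1) (at y)"
    by (auto intro!: derivative_eq_intros)
  from vector_diff_chain_at[OF this 2]
  have "((\<lambda>t. f x t) has_vector_derivative dy f x (y + 1)) (at y)"
    by (simp add: o_def assms)
  with 1 show "dy f x (y + 1) = dy f x y" by (rule vector_derivative_unique_at[symmetric])
qed

lemma XiD:
  assumes "f \<in> Xi"
  shows "smooth f" "f x (y + 1) = f x y"
    "\<exists>C. \<forall>x y. \<bar>x\<bar> ^ n * norm (iter_partial ds f x y) \<le> C"
  using assms unfolding Xi_def by blast+

lemma Xi_partial:
  assumes "f \<in> Xi" shows "dx f \<in> Xi" "dy f \<in> Xi"
proof -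
  have "dx f x (y + 1) = dx f x y" for x y
    by (rule periodic_partial(1)) (rule XiD(2)[OF assms])
  then show "dx f \<in> Xi"
    using XiD(3)[OF assms] smooth_partial(1)[OF XiD(1)[OF assms]]
    by (simp add: Xi_def iter_partial_partial)
  have "dy f x (y + 1) = dy f x y" for x y
    by (rule periodic_partial(2)) (rule XiD(2)[OF assms] smoothD[OF XiD(1)[OF assms]])+
  then show "dy f \<in> Xi"
    using XiD(3)[OF assms] smooth_partial(2)[OF XiD(1)[OF assms]]
    by (simp add: Xi_def iter_partial_partial)
qed

lemmas Xi_has_dx = smoothD(2)[OF XiD(1)]
lemmas Xi_has_dy = smoothD(3)[OF XiD(1)]

text \<open>
  Membership in \<open>\<Xi>\<close> refers to all iterated derivatives, which have no closed form. It is shown by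
  coinduction: a set of functions closed under both partial derivatives need only be checked for
  the conditions of order zero.
\<close>

lemma Xi_coinduct [consumes 1, case_names step]:
  assumes "f \<in> S"
    and step: "\<And>g. g \<in> S \<Longrightarrow> continuous_on UNIV (\<lambda>z. g (fst z) (snd z)) \<and>
      (\<forall>x y. (\<lambda>s. g s y) differentiable (at x)) \<and> (\<forall>x y. (\<lambda>t. g x t) differentiable (at y)) \<and>
      (\<forall>x y. g x (y + 1) = g x y) \<and> (\<forall>n. \<exists>C. \<forall>x y. \<bar>x\<bar> ^ n * norm (g x y) \<le> C) \<and>
      dx g \<in> S \<and> dy g \<in> S"
  shows "f \<in> Xi"
proof -
  have "iter_partial ds f \<in> S" for ds
    by (induction ds) (use assms in \<open>auto simp: iter_partial_Cons\<close>)
  then show ?thesis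
    using step assms(1) unfolding Xi_def smooth_def by blast
qed

lemma dx_add:
  assumes "f \<in> Xi" "g \<in> Xi"
  shows "dx (\<lambda>x y. f x y + g x y) = (\<lambda>x y. dx f x y + dx g x y)"
  unfolding dx_def[of "\<lambda>x y. f x y + g x y"]
  by (intro ext vector_derivative_at has_vector_derivative_add Xi_has_dx assms)

lemma dy_add:
  assumes "f \<in> Xi" "g \<in> Xi"
  shows "dy (\<lambda>x y. f x y + g x y) = (\<lambda>x y. dy f x y + dy g x y)"
  unfolding dy_def[of "\<lambda>x y. f x y + g x y"]
  by (intro ext vector_derivative_at has_vector_derivative_add Xi_has_dy assms)

lemma dx_cmult: "f \<in> Xi \<Longrightarrow> dx (\<lambda>x y. a * f x y) = (\<lambda>x y. a * dx f x y)"
  unfolding dx_def[of "\<lambda>x y. a * f x y"]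
  by (intro ext vector_derivative_at has_vector_derivative_mult_right Xi_has_dx)

lemma dy_cmult: "f \<in> Xi \<Longrightarrow> dy (\<lambda>x y. a * f x y) = (\<lambda>x y. a * dy f x y)"
  unfolding dy_def[of "\<lambda>x y. a * f x y"]
  by (intro ext vector_derivative_at has_vector_derivative_mult_right Xi_has_dy)

lemma Xi_differentiable:
  assumes "f \<in> Xi"
  shows "(\<lambda>s. f s y) differentiable (at x)" "(\<lambda>t. f x t) differentiable (at y)"
  using Xi_has_dx[OF assms] Xi_has_dy[OF assms] differentiableI_vector by blast+

lemma Xi_bound: "f \<in> Xi \<Longrightarrow> \<exists>C. \<forall>x y. \<bar>x\<bar> ^ n * norm (f x y) \<le> C"
  using XiD(3)[of f n "[]"] by simp

lemma Xi_add:
  assumes "f \<in> Xi" "g \<in> Xi"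
  shows "(\<lambda>x y. f x y + g x y) \<in> Xi"
proof (rule Xi_coinduct[of _ "{\<lambda>x y. f x y + g x y | f g. f \<in> Xi \<and> g \<in> Xi}"])
  show "(\<lambda>x y. f x y + g x y) \<in> {\<lambda>x y. f x y + g x y | f g. f \<in> Xi \<and> g \<in> Xi}"
    using assms by blast
  fix h assume "h \<in> {\<lambda>x y. f x y + g x y | f g. f \<in> Xi \<and> g \<in> Xi}"
  then obtain f g where fg: "f \<in> Xi" "g \<in> Xi" and h: "h = (\<lambda>x y. f x y + g x y)" by blast
  have "\<exists>C. \<forall>x y. \<bar>x\<bar> ^ n * norm (h x y) \<le> C" for n
  proof -
    obtain C D where C: "\<And>x y. \<bar>x\<bar> ^ n * norm (f x y) \<le> C" "\<And>x y. \<bar>x\<bar> ^ n * norm (g x y) \<le> D"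
      using Xi_bound fg by metis
    have "\<bar>x\<bar> ^ n * norm (h x y) \<le> \<bar>x\<bar> ^ n * (norm (f x y) + norm (g x y))" for x y
      unfolding h by (intro mult_left_mono norm_triangle_ineq) auto
    moreover have "\<bar>x\<bar> ^ n * (norm (f x y) + norm (g x y)) \<le> C + D" for x y
      unfolding distrib_left by (intro add_mono C)
    ultimately show ?thesis using order_trans by blast
  qed
  moreover have "continuous_on UNIV (\<lambda>z. h (fst z) (snd z))"
    unfolding h by (intro continuous_on_add smoothD(1) XiD(1) fg)
  ultimately show "continuous_on UNIV (\<lambda>z. h (fst z) (snd z)) \<and>
      (\<forall>x y. (\<lambda>s. h s y) differentiable (at x)) \<and> (\<forall>x y. (\<lambda>t. h x t) differentiable (at y)) \<and>
      (\<forall>x y. h x (y + 1) = h x y) \<and> (\<forall>n. \<exists>C. \<forall>x y. \<bar>x\<bar> ^ n * norm (h x y) \<le> C) \<and>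
      dx h \<in> {\<lambda>x y. f x y + g x y | f g. f \<in> Xi \<and> g \<in> Xi} \<and>
      dy h \<in> {\<lambda>x y. f x y + g x y | f g. f \<in> Xi \<and> g \<in> Xi}"
    using fg Xi_partial
    by (simp add: h dx_add dy_add Xi_differentiable differentiable_add XiD(2)) blast
qed

lemma Xi_cmult:
  assumes "f \<in> Xi" shows "(\<lambda>x y. a * f x y) \<in> Xi"
proof (rule Xi_coinduct[of _ "{\<lambda>x y. a * f x y | f. f \<in> Xi}"])
  show "(\<lambda>x y. a * f x y) \<in> {\<lambda>x y. a * f x y | f. f \<in> Xi}"
    using assms by blast
  fix h assume "h \<in> {\<lambda>x y. a * f x y | f. f \<in> Xi}"
  then obtain f where f: "f \<in> Xi" and h: "h = (\<lambda>x y. a * f x y)" by blast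
  have "\<exists>C. \<forall>x y. \<bar>x\<bar> ^ n * norm (h x y) \<le> C" for n
  proof -
    obtain C where "\<And>x y. \<bar>x\<bar> ^ n * norm (f x y) \<le> C" using Xi_bound[OF f] by blast
    then have "norm a * (\<bar>x\<bar> ^ n * norm (f x y)) \<le> norm a * C" for x y
      by (intro mult_left_mono) auto
    then show ?thesis by (auto simp: h norm_mult mult_ac)
  qed
  moreover have "continuous_on UNIV (\<lambda>z. h (fst z) (snd z))"
    unfolding h by (intro continuous_on_mult continuous_on_const smoothD(1) XiD(1) f)
  ultimately show "continuous_on UNIV (\<lambda>z. h (fst z) (snd z)) \<and>
      (\<forall>x y. (\<lambda>s. h s y) differentiable (at x)) \<and> (\<forall>x y. (\<lambda>t. h x t) differentiable (at y)) \<and>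
      (\<forall>x y. h x (y + 1) = h x y) \<and> (\<forall>n. \<exists>C. \<forall>x y. \<bar>x\<bar> ^ n * norm (h x y) \<le> C) \<and>
      dx h \<in> {\<lambda>x y. a * f x y | f. f \<in> Xi} \<and> dy h \<in> {\<lambda>x y. a * f x y | f. f \<in> Xi}"
    using f Xi_partial
    by (simp add: h dx_cmult dy_cmult Xi_differentiable differentiable_mult XiD(2)) blast
qed

text \<open>
  Functions \<open>x f\<close> alone are not closed under \<open>\<partial>/\<partial>x\<close>, but the functions \<open>g + x f\<close> with \<open>f, g \<in> \<Xi>\<close> are.
\<close>

lemma Xi_xmult:
  assumes "f \<in> Xi" shows "(\<lambda>x y. of_real x * f x y) \<in> Xi"
proof -
  let ?S = "{\<lambda>x y. g x y + of_real x * f x y | f g. f \<in> Xi \<and> g \<in> Xi}"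
  have zero: "(\<lambda>x y. 0) \<in> Xi" using Xi_cmult[OF assms, of 0] by simp
  show ?thesis
  proof (rule Xi_coinduct[of _ ?S])
    show "(\<lambda>x y. of_real x * f x y) \<in> ?S" using assms zero
      by (intro CollectI exI[of _ f] exI[of _ "\<lambda>x y. 0"]) auto
    fix h assume "h \<in> ?S"
    then obtain f g where fg: "f \<in> Xi" "g \<in> Xi" and h: "h = (\<lambda>x y. g x y + of_real x * f x y)" by blast
    have "\<exists>C. \<forall>x y. \<bar>x\<bar> ^ n * norm (h x y) \<le> C" for n
    proof -
      obtain C D where C: "\<And>x y. \<bar>x\<bar> ^ Suc n * norm (f x y) \<le> C" "\<And>x y. \<bar>x\<bar> ^ n * norm (g x y) \<le> D"
        using Xi_bound fg by metis
      have "\<bar>x\<bar> ^ n * norm (h x y) \<le> \<bar>x\<bar> ^ n * (norm (g x y) + norm (of_real x * f x y))" for x y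
        unfolding h by (intro mult_left_mono norm_triangle_ineq) auto
      moreover have "\<bar>x\<bar> ^ n * (norm (g x y) + norm (of_real x * f x y)) \<le> D + C" for x y
        using add_mono[OF C(2)[of x y] C(1)[of x y]] by (simp add: norm_mult algebra_simps)
      ultimately show ?thesis using order_trans by blast
    qed
    moreover have "continuous_on UNIV (\<lambda>z. h (fst z) (snd z))"
      unfolding h by (intro continuous_intros smoothD(1) XiD(1) fg)
    moreover have derx: "((\<lambda>s. h s y) has_vector_derivative
        (dx g x y + f x y) + of_real x * dx f x y) (at x)" for x y
    proof -
      have "((\<lambda>s. h s y) has_vector_derivative
          (dx g x y + (of_real x * dx f x y + of_real 1 * f x y))) (at x)"
        unfolding h
        by (intro has_vector_derivative_add has_vector_derivative_mult has_vector_derivative_of_real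
            Xi_has_dx fg derivative_intros)
      then show ?thesis by (simp add: add_ac)
    qed
    moreover have dery: "((\<lambda>t. h x t) has_vector_derivative dy g x y + of_real x * dy f x y) (at y)" for x y
      unfolding h by (intro has_vector_derivative_add has_vector_derivative_mult_right Xi_has_dy fg)
    moreover have "dx h \<in> ?S"
    proof -
      have "dx h = (\<lambda>x y. (dx g x y + f x y) + of_real x * dx f x y)"
        by (intro ext) (simp add: dx_def[of h] vector_derivative_at[OF derx])
      moreover have "(\<lambda>x y. dx g x y + f x y) \<in> Xi" using fg by (intro Xi_add Xi_partial)
      ultimately show ?thesis using Xi_partial(1)[OF fg(1)]
        by (intro CollectI exI[of _ "dx f"] exI[of _ "\<lambda>x y. dx g x y + f x y"]) simp
    qed
    moreover have "dy h \<in> ?S"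
    proof -
      have "dy h = (\<lambda>x y. dy g x y + of_real x * dy f x y)"
        by (intro ext) (simp add: dy_def[of h] vector_derivative_at[OF dery])
      then show ?thesis using Xi_partial(2)[OF fg(1)] Xi_partial(2)[OF fg(2)]
        by (intro CollectI exI[of _ "dy f"] exI[of _ "dy g"]) simp
    qed
    moreover have "h x (y + 1) = h x y" for x y
      by (simp add: h XiD(2)[OF fg(1)] XiD(2)[OF fg(2)])
    ultimately show "continuous_on UNIV (\<lambda>z. h (fst z) (snd z)) \<and>
      (\<forall>x y. (\<lambda>s. h s y) differentiable (at x)) \<and> (\<forall>x y. (\<lambda>t. h x t) differentiable (at y)) \<and>
      (\<forall>x y. h x (y + 1) = h x y) \<and> (\<forall>n. \<exists>C. \<forall>x y. \<bar>x\<bar> ^ n * norm (h x y) \<le> C) \<and>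
      dx h \<in> ?S \<and> dy h \<in> ?S"
      using differentiableI_vector by (intro conjI allI) blast+
  qed
qed

lemma rapid_Xi:
  assumes "f \<in> Xi" shows "rapid f"
  unfolding rapid_def
  by (rule exI[of _ 0]) (use Xi_bound[OF assms] in simp)

text \<open>
  Write \<open>f(s, t)\<close> as \<open>f(s, a)\<close> plus the integral of \<open>\<partial>f/\<partial>y\<close> over \<open>[a, t]\<close>. Differentiating under the
  integral sign in \<open>s\<close> and then applying the fundamental theorem of calculus in \<open>t\<close> yields the claim.
\<close>

lemma mixed_partials:
  assumes f: "f \<in> Xi"
  shows "dx (dy f) x y = dy (dx f) x y"
proof -
  define a where "a = y - 1"
  define b where "b = y + 1"
  let ?k = "dx (dy f)"
  have k: "?k \<in> Xi" and dyf: "dy f \<in> Xi" and dxf: "dx f \<in> Xi" using f Xi_partial by auto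
  have cont: "continuous_on T (\<lambda>t. g s t)" if "g \<in> Xi" for g s T
    by (rule continuous_on_subset[OF continuous_on_compose2[OF smoothD(1)[OF XiD(1)[OF that]],
          of UNIV "\<lambda>t. (s, t)", simplified]]) (auto intro: continuous_intros)
  have ftc: "f s t = f s a + integral {a..t} (dy f s)" if "t \<in> {a..b}" for s t
  proof -
    have "(dy f s has_integral (f s t - f s a)) {a..t}"
      using that by (intro fundamental_theorem_of_calculus)
        (auto intro!: has_vector_derivative_at_within Xi_has_dy f)
    then show ?thesis by (simp add: integral_unique)
  qed
  have dxt: "dx f x t = dx f x a + integral {a..t} (?k x)" if t: "t \<in> {a..b}" for t
  proof -
    have "((\<lambda>s. integral (cbox a t) (dy f s)) has_vector_derivative integral (cbox a t) (?k x)) (at x within UNIV)"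
    proof (rule leibniz_rule_vector_derivative)
      show "((\<lambda>s. dy f s u) has_vector_derivative ?k s u) (at s within UNIV)" for s u
        using Xi_has_dx[OF dyf] by simp
      show "dy f s integrable_on cbox a t" for s
        by (intro integrable_continuous cont dyf)
      show "continuous_on (UNIV \<times> cbox a t) (\<lambda>(s, u). ?k s u)"
        unfolding case_prod_beta
        by (rule continuous_on_subset[OF smoothD(1)[OF XiD(1)[OF k]]]) auto
    qed auto
    then have "((\<lambda>s. f s a + integral {a..t} (dy f s)) has_vector_derivative
        (dx f x a + integral {a..t} (?k x))) (at x)"
      by (intro has_vector_derivative_add Xi_has_dx f) auto
    then have "((\<lambda>s. f s t) has_vector_derivative (dx f x a + integral {a..t} (?k x))) (at x)"
      using ftc[OF t] by simp
    then show ?thesis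
      by (rule vector_derivative_unique_at[OF Xi_has_dx[OF f]])
  qed
  have y: "y \<in> {a<..<b}" by (simp add: a_def b_def)
  have "((\<lambda>t. integral {a..t} (?k x)) has_vector_derivative ?k x y) (at y within {a..b})"
    using y by (intro integral_has_vector_derivative cont k) auto
  then have "((\<lambda>t. integral {a..t} (?k x)) has_vector_derivative ?k x y) (at y)"
    using y at_within_interior[of y "{a..b}"] by simp
  then have "((\<lambda>t. dx f x a + integral {a..t} (?k x)) has_vector_derivative (0 + ?k x y)) (at y)"
    by (intro has_vector_derivative_add) auto
  then have "((\<lambda>t. dx f x t) has_vector_derivative (0 + ?k x y)) (at y)"
  proof (rule has_vector_derivative_transform_within_open[where S = "{a<..<b}"])
    show "dx f x a + integral {a..t} (?k x) = dx f x t" if "t \<in> {a<..<b}" for t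
      by (rule dxt[symmetric]) (use that in auto)
  qed (use y in auto)
  from vector_derivative_unique_at[OF this Xi_has_dy[OF dxf]] show ?thesis by simp
qed

section \<open>Gaussians and faithfulness of the left action\<close>

text \<open>
  Combine \<open>\<bar>x\<bar>\<^sup>n \<le> n! exp \<bar>x\<bar>\<close> with \<open>\<bar>x - b\<bar> \<le> 1 + (x - b)\<^sup>2\<close>. The bound is uniform in \<open>m\<close>.
\<close>

lemma power_exp_quadratic_bound:
  fixes m b x :: real
  assumes "1 \<le> m"
  shows "\<bar>x\<bar> ^ n * exp (- m * (x - b)\<^sup>2) \<le> fact n * exp (\<bar>b\<bar> + 1)"
proof -
  have "\<bar>x\<bar> ^ n /\<^sub>R fact n \<le> exp \<bar>x\<bar>"
    unfolding exp_def
    using sum_le_suminf[OF summable_exp_generic[of "\<bar>x\<bar>"], of "{n}"] by simp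
  then have "\<bar>x\<bar> ^ n \<le> fact n * exp \<bar>x\<bar>" by (simp add: field_simps)
  then have "\<bar>x\<bar> ^ n * exp (- m * (x - b)\<^sup>2) \<le> fact n * exp \<bar>x\<bar> * exp (- m * (x - b)\<^sup>2)"
    by (rule mult_right_mono) simp
  also have "\<dots> = fact n * exp (\<bar>x\<bar> - m * (x - b)\<^sup>2)" by (simp add: exp_diff exp_minus field_simps)
  also have "\<dots> \<le> fact n * exp (\<bar>b\<bar> + 1)"
  proof -
    have "0 \<le> (\<bar>x - b\<bar> - 1/2)\<^sup>2" by simp
    also have "\<dots> = (x - b)\<^sup>2 - \<bar>x - b\<bar> + 1/4"
      unfolding power2_diff[of "\<bar>x - b\<bar>"] by (simp add: power_divide)
    finally have "\<bar>x - b\<bar> \<le> 1 + (x - b)\<^sup>2" by linarith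
    moreover have "(x - b)\<^sup>2 \<le> m * (x - b)\<^sup>2" using assms by (simp add: mult_le_cancel_right1)
    ultimately have "\<bar>x\<bar> - m * (x - b)\<^sup>2 \<le> \<bar>b\<bar> + 1" by linarith
    then show ?thesis by simp
  qed
  finally show ?thesis .
qed

definition gaussian :: "real \<Rightarrow> real \<Rightarrow> plane_fun" where
  "gaussian m b = (\<lambda>x y. of_real (exp (- m * (x - b)\<^sup>2)))"

text \<open>
  The polynomial multiples of a Gaussian are closed under differentiation, which is what the coinduction
  needs.
\<close>

lemma gaussian_Xi:
  assumes "1 \<le> m"
  shows "gaussian m b \<in> Xi"
proof -
  let ?G = "\<lambda>P x y. poly P (of_real x) * gaussian m b x y"
  let ?S = "range ?G"
  show ?thesis
  proof (rule Xi_coinduct[of _ ?S])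
    show "gaussian m b \<in> ?S" by (rule image_eqI[of _ _ 1]) auto
    fix g assume "g \<in> ?S"
    then obtain P where g: "g = ?G P" by blast
    let ?P' = "pderiv P + P * [:of_real (2 * m * b), - of_real (2 * m):]"
    have derx: "((\<lambda>s. g s y) has_vector_derivative ?G ?P' x y) (at x)" for x y
    proof -
      have "((\<lambda>s. exp (- m * (s - b)\<^sup>2)) has_real_derivative
          exp (- m * (x - b)\<^sup>2) * (- (m * (2 * (x - b))))) (at x)"
        by (auto intro!: derivative_eq_intros)
      then have 1: "((\<lambda>s. gaussian m b s y) has_vector_derivative
          of_real (exp (- m * (x - b)\<^sup>2) * (- (m * (2 * (x - b)))))) (at x)"
        unfolding gaussian_def
        by (intro has_vector_derivative_of_real) (simp add: has_real_derivative_iff_has_vector_derivative)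
      have "((\<lambda>s. of_real s :: complex) has_vector_derivative 1) (at x)"
        by (auto intro!: derivative_eq_intros)
      then have 2: "((\<lambda>s. poly P (of_real s)) has_vector_derivative poly (pderiv P) (of_real x)) (at x)"
        using field_vector_diff_chain_at[OF _ poly_DERIV, of of_real 1 x] by (simp add: o_def)
      show ?thesis
        using has_vector_derivative_mult[OF 2 1] unfolding g
        by (rule has_vector_derivative_eq_rhs) (simp add: gaussian_def algebra_simps)
    qed
    have dery: "((\<lambda>t. g x t) has_vector_derivative 0) (at y)" for x y
      by (simp add: g gaussian_def)
    have bound: "\<exists>C. \<forall>x y. \<bar>x\<bar> ^ n * norm (?G Q x y) \<le> C" for Q n
    proof (induction Q arbitrary: n)
      case 0
      then show ?case by auto
    next
      case (pCons a Q)
      obtain C where C: "\<And>x y. \<bar>x\<bar> ^ Suc n * norm (?G Q x y) \<le> C" using pCons.IH[of "Suc n"] by blast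
      have "\<bar>x\<bar> ^ n * norm (?G (pCons a Q) x y) \<le> norm a * (fact n * exp (\<bar>b\<bar> + 1)) + C" for x y
      proof -
        let ?g = "exp (- m * (x - b)\<^sup>2)"
        have "\<bar>x\<bar> ^ n * norm (?G (pCons a Q) x y) = \<bar>x\<bar> ^ n * (norm (a + of_real x * poly Q (of_real x)) * ?g)"
          by (simp add: norm_mult gaussian_def)
        also have "\<dots> \<le> \<bar>x\<bar> ^ n * ((norm a + norm (of_real x * poly Q (of_real x))) * ?g)"
          by (intro mult_left_mono mult_right_mono norm_triangle_ineq) auto
        also have "\<dots> = norm a * (\<bar>x\<bar> ^ n * ?g) + \<bar>x\<bar> ^ Suc n * norm (?G Q x y)"
          by (simp add: norm_mult gaussian_def algebra_simps)
        also have "\<dots> \<le> norm a * (fact n * exp (\<bar>b\<bar> + 1)) + C"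
          by (intro add_mono mult_left_mono power_exp_quadratic_bound assms C) auto
        finally show ?thesis .
      qed
      then show ?case by blast
    qed
    have "dx g = ?G ?P'"
      unfolding dx_def using vector_derivative_at[OF derx] by blast
    then have "dx g \<in> ?S" by (intro image_eqI[of _ _ ?P']) auto
    moreover have "dy g = ?G 0"
      unfolding dy_def using vector_derivative_at[OF dery] by simp
    then have "dy g \<in> ?S" by (intro image_eqI[of _ _ 0]) auto
    moreover have "continuous_on UNIV (\<lambda>z. g (fst z) (snd z))"
      unfolding g gaussian_def by (intro continuous_intros)
    moreover have "g x (y + 1) = g x y" for x y by (simp add: g gaussian_def)
    ultimately show "continuous_on UNIV (\<lambda>z. g (fst z) (snd z)) \<and>
      (\<forall>x y. (\<lambda>s. g s y) differentiable (at x)) \<and> (\<forall>x y. (\<lambda>t. g x t) differentiable (at y)) \<and>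
      (\<forall>x y. g x (y + 1) = g x y) \<and> (\<forall>n. \<exists>C. \<forall>x y. \<bar>x\<bar> ^ n * norm (g x y) \<le> C) \<and>
      dx g \<in> ?S \<and> dy g \<in> ?S"
      using differentiableI_vector[OF derx] differentiableI_vector[OF dery] bound[of _ P]
      unfolding g by blast
  qed
qed

lemma has_sum_minus:
  fixes f g :: "'a \<Rightarrow> complex"
  assumes "(f has_sum a) A" "(g has_sum b) A"
  shows "((\<lambda>x. f x - g x) has_sum (a - b)) A"
  using has_sum_add[OF assms(1) has_sum_uminusI[OF assms(2)]] by simp

lemma has_sum_int_single: "((\<lambda>q::int. if q = p then a else 0) has_sum (a::complex)) UNIV"
  by (rule has_sum_finite_neutralI[of "{p}"]) auto

text \<open>
  The value of \<open>\<Theta> \<cdot> f\<close> at \<open>(x, y)\<close> is \<open>\<Sum>\<^sub>q cnj (\<Theta> x y q) f(x + q, y)\<close>. For a Gaussian of width tending to \<open>0\<close>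
  centred at \<open>x + p\<close> all terms except \<open>q = p\<close> vanish in the limit, so the action determines every
  coefficient \<open>\<Theta> x y p\<close>.
\<close>

lemma E_act_faithful:
  assumes T: "smooth_rapid T" and T': "smooth_rapid T'"
    and eq: "\<And>f. f \<in> Xi \<Longrightarrow> E_act T f = E_act T' f"
  shows "T = T'"
proof (intro ext)
  fix x y :: real and p :: int
  let ?w = "\<lambda>q::int. inverse ((1 + real_of_int \<bar>q\<bar>)\<^sup>2)"
  have bd: "\<exists>C. \<forall>q. norm (\<Theta> x y q) \<le> C" if "smooth_rapid \<Theta>" for \<Theta>
  proof -
    from that obtain C where "\<forall>a\<in>{x..x}. \<forall>b q. \<bar>of_int q\<bar> ^ 0 * norm (iter_partial [] (\<lambda>x y. \<Theta> x y q) a b) \<le> C"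
      unfolding smooth_rapid_def by blast
    then show ?thesis by auto
  qed
  obtain K K' where K: "\<And>q. norm (T x y q) \<le> K" "\<And>q. norm (T' x y q) \<le> K'"
    using bd[OF T] bd[OF T'] by blast
  define d where "d q = cnj (T x y q) - cnj (T' x y q)" for q
  have d: "norm (d q) \<le> K + K'" for q
    unfolding d_def using norm_triangle_ineq4[of "cnj (T x y q)" "cnj (T' x y q)"] K[of q] by simp
  have KK: "0 \<le> K + K'" using d[of 0] norm_ge_zero order_trans by blast
  have "bij_betw (\<lambda>q. q - p) UNIV UNIV"
    by (rule bij_betwI[where g = "\<lambda>q. q + p"]) auto
  then have sw: "(\<lambda>q. ?w (q - p)) summable_on UNIV"
    using summable_on_int_inverse_square summable_on_reindex_bij_betw[of "\<lambda>q. q - p" UNIV UNIV ?w] by blast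
  define W where "W = (\<Sum>\<^sub>\<infinity>q. ?w (q - p))"
  have peak: "exp (- m * (real_of_int j)\<^sup>2) \<le> 4 / m * ?w j" if "1 \<le> m" "j \<noteq> 0" for m j
  proof -
    have j1: "1 \<le> \<bar>real_of_int j\<bar>" using that by linarith
    have "(1 + \<bar>real_of_int j\<bar>)\<^sup>2 \<le> (2 * \<bar>real_of_int j\<bar>)\<^sup>2"
      using j1 by (intro power_mono) auto
    then have "(1 + \<bar>real_of_int j\<bar>)\<^sup>2 \<le> 4 * (real_of_int j)\<^sup>2" by (simp add: power_mult_distrib)
    then have "m * (1 + \<bar>real_of_int j\<bar>)\<^sup>2 \<le> 4 * (m * (real_of_int j)\<^sup>2)"
      using that by (simp add: mult_left_mono)
    also have "\<dots> \<le> 4 * exp (m * (real_of_int j)\<^sup>2)"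
      using exp_ge_add_one_self[of "m * (real_of_int j)\<^sup>2"] by linarith
    finally show ?thesis
      using that j1 by (simp add: exp_minus field_simps)
  qed
  (* A bound of order 1/m suffices: letting m tend to infinity gives d p = 0. *)
  have main: "norm (d p) \<le> (K + K') * 4 / m * W" if m: "1 \<le> m" for m
  proof -
    define G where "G q = gaussian m (x + of_int p) (x + of_int q) y" for q :: int
    have G: "G q = of_real (exp (- m * (real_of_int (q - p))\<^sup>2))" for q
      by (simp add: G_def gaussian_def)
    have Gle: "norm (G q) \<le> 4 * ?w (q - p)" for q
    proof (cases "q = p")
      case False
      then have "norm (G q) \<le> 4 / m * ?w (q - p)" using peak[OF m, of "q - p"] by (simp add: G)
      also have "\<dots> \<le> 4 * ?w (q - p)" using m by (intro mult_right_mono) (auto simp: field_simps)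
      finally show ?thesis .
    qed (simp add: G)
    have sum: "(\<lambda>q. a q * G q) summable_on UNIV" if "\<And>q. norm (a q) \<le> A" for a A
    proof -
      have "0 \<le> A" using that[of 0] norm_ge_zero order_trans by blast
      then have "(\<lambda>q. norm (a q * G q)) summable_on UNIV"
        using that Gle
        by (intro Infinite_Sum.abs_summable_on_comparison_test'[where g = "\<lambda>q. A * (4 * ?w (q - p))"]
              summable_on_cmult_right sw) (auto simp: norm_mult intro!: mult_mono)
      then show ?thesis by (rule abs_summable_summable)
    qed
    have "gaussian m (x + of_int p) \<in> Xi" using m by (rule gaussian_Xi)
    from eq[OF this] have "E_act T (gaussian m (x + of_int p)) x y = E_act T' (gaussian m (x + of_int p)) x y"
      by simp
    then have "(\<Sum>\<^sub>\<infinity>q. cnj (T x y q) * G q) = (\<Sum>\<^sub>\<infinity>q. cnj (T' x y q) * G q)"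
      by (simp add: E_act_def G_def)
    moreover have "((\<lambda>q. cnj (T x y q) * G q - cnj (T' x y q) * G q) has_sum
        ((\<Sum>\<^sub>\<infinity>q. cnj (T x y q) * G q) - (\<Sum>\<^sub>\<infinity>q. cnj (T' x y q) * G q))) UNIV"
      using K by (intro has_sum_minus has_sum_infsum sum) auto
    ultimately have "((\<lambda>q. d q * G q) has_sum 0) UNIV"
      by (simp add: d_def algebra_simps)
    from has_sum_minus[OF this has_sum_int_single[of p "d p"]]
    have "((\<lambda>q. d q * G q - (if q = p then d p else 0)) has_sum - d p) UNIV" by simp
    moreover have "((\<lambda>q. (K + K') * 4 / m * ?w (q - p)) has_sum ((K + K') * 4 / m * W)) UNIV"
      unfolding W_def by (intro has_sum_cmult_right has_sum_infsum sw)
    moreover have "norm (d q * G q - (if q = p then d p else 0)) \<le> (K + K') * 4 / m * ?w (q - p)" for q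
    proof (cases "q = p")
      case False
      then have "norm (d q) * norm (G q) \<le> (K + K') * (4 / m * ?w (q - p))"
        using peak[OF m, of "q - p"] d KK by (intro mult_mono) (auto simp: G)
      with False show ?thesis by (simp add: norm_mult algebra_simps)
    qed (use KK m in \<open>simp add: G\<close>)
    ultimately have "norm (- d p) \<le> (K + K') * 4 / m * W"
      by (rule norm_infsum_le)
    then show ?thesis by simp
  qed
  have "((\<lambda>m. (K + K') * 4 * W * inverse m) \<longlongrightarrow> (K + K') * 4 * W * 0) at_top"
    by (intro tendsto_intros tendsto_inverse_0_at_top filterlim_ident)
  then have "norm (d p) \<le> 0"
    by (intro tendsto_lowerbound[where F = at_top and f = "\<lambda>m. (K + K') * 4 * W * inverse m"])
      (auto intro!: eventually_mono[OF eventually_ge_at_top[of 1]] dest!: main simp: field_simps)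
  then show "T x y p = T' x y p" by (simp add: d_def)
qed

section \<open>A two-parameter family of connections\<close>

text \<open>
  The phases are the coefficients of \<open>\<nabla>\<^sub>X\<close> and \<open>\<nabla>\<^sub>Z\<close> divided by \<open>\<i>\<close>. They are kept as real functions so
  that skew-adjointness is visible and their translation rules are identities between real numbers.
\<close>

definition X_phase :: "int \<Rightarrow> real \<Rightarrow> real \<Rightarrow> real \<Rightarrow> real \<Rightarrow> real \<Rightarrow> real" where
  "X_phase c \<mu> \<nu> r x y = pi * of_int c / (2 * \<mu>) * x\<^sup>2 + r * (\<mu> * y - \<nu> * x)"

definition Z_phase :: "real \<Rightarrow> real \<Rightarrow> real \<Rightarrow> real" where
  "Z_phase \<mu> s x = pi * x / \<mu> + s"

definition heis_conn :: "int \<Rightarrow> real \<Rightarrow> real \<Rightarrow> real \<Rightarrow> real \<Rightarrow> conn" where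
  "heis_conn c \<mu> \<nu> r s W f = (\<lambda>x y.
     of_real (fst W) * (- dy f x y + \<i> * of_real (X_phase c \<mu> \<nu> r x y) * f x y) +
     of_real (fst (snd W)) * (- dx f x y) +
     of_real (snd (snd W)) * (\<i> * of_real (Z_phase \<mu> s x) * f x y))"

lemma X_phase_translate:
  assumes "\<mu> \<noteq> 0"
  shows "X_phase c \<mu> \<nu> r (x + q * (2 * \<mu>)) (y + q * (2 * \<nu>)) = X_phase c \<mu> \<nu> r x y + 2 * pi * of_int c * q * (x + q * \<mu>)"
  using assms unfolding X_phase_def by (simp add: field_simps power2_eq_square)

lemma Z_phase_translate:
  assumes "\<mu> \<noteq> 0"
  shows "Z_phase \<mu> s (x + q * (2 * \<mu>)) = Z_phase \<mu> s x + 2 * pi * q"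
  using assms unfolding Z_phase_def by (simp add: field_simps)

text \<open>
  A sum of multiples of \<open>f\<close>, \<open>dx f\<close>, \<open>dy f\<close> by monomials in \<open>x\<close> and \<open>y\<close>, so that the closure properties of
  rapidly decreasing functions and of \<open>\<Xi>\<close> apply summand by summand.
\<close>

lemma heis_conn_expand:
  "heis_conn c \<mu> \<nu> r s W f = (\<lambda>x y.
     - of_real (fst W) * dy f x y + (- of_real (fst (snd W)) * dx f x y +
     (of_real (fst W) * \<i> * of_real (pi * of_int c / (2 * \<mu>)) * (of_real x * (of_real x * f x y)) +
     (\<i> * (of_real (snd (snd W)) * of_real (pi / \<mu>) - of_real (fst W) * of_real (r * \<nu>)) * (of_real x * f x y) +
     (\<i> * of_real (snd (snd W)) * of_real s * f x y +
      of_real (fst W) * \<i> * of_real (r * \<mu>) * (of_real y * f x y))))))"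
  unfolding heis_conn_def X_phase_def Z_phase_def
  by (intro ext) (simp add: algebra_simps power2_eq_square)

lemma rapid_heis_conn:
  assumes "f \<in> Xi" shows "rapid (heis_conn c \<mu> \<nu> r s W f)"
  unfolding heis_conn_expand
  by (intro rapid_add rapid_cmult rapid_xmult rapid_ymult rapid_Xi Xi_partial assms)

text \<open>
  For \<open>r = 0\<close> no coefficient depends on \<open>y\<close>, so periodicity in \<open>y\<close> is preserved.
\<close>

lemma heis_conn_Xi:
  assumes "f \<in> Xi" shows "heis_conn c \<mu> \<nu> 0 s W f \<in> Xi"
proof -
  have "heis_conn c \<mu> \<nu> 0 s W f = (\<lambda>x y.
     - of_real (fst W) * dy f x y + (- of_real (fst (snd W)) * dx f x y +
     (of_real (fst W) * \<i> * of_real (pi * of_int c / (2 * \<mu>)) * (of_real x * (of_real x * f x y)) +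
     (\<i> * (of_real (snd (snd W)) * of_real (pi / \<mu>)) * (of_real x * f x y) +
      \<i> * of_real (snd (snd W)) * of_real s * f x y))))"
    by (simp add: heis_conn_expand)
  also have "\<dots> \<in> Xi"
    by (intro Xi_add Xi_cmult Xi_xmult Xi_partial assms)
  finally show ?thesis .
qed

section \<open>The Leibniz rule for the module action\<close>

lemma has_vector_derivative_shift:
  fixes g :: "real \<Rightarrow> complex"
  assumes "(g has_vector_derivative d) (at (x + a))"
  shows "((\<lambda>s. g (s + a)) has_vector_derivative d) (at x)"
proof -
  have "((\<lambda>s. s + a) has_vector_derivative 1) (at x)"
    by (auto intro!: derivative_eq_intros)
  from vector_diff_chain_at[OF this assms] show ?thesis by (simp add: o_def)
qed

lemma norm_e [simp]: "norm (e t) = 1"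
  unfolding e_def using norm_exp_i_times[of "2 * pi * t"] by (simp add: mult_ac)

lemma e_mult_cnj: "e t * cnj (e t) = 1"
  using complex_norm_square[of "e t"] by simp

lemma has_vector_derivative_e:
  "((\<lambda>t. e (a * (t - b))) has_vector_derivative 2 * of_real pi * \<i> * of_real a * e (a * (y - b))) (at y)"
proof -
  have "((\<lambda>t. of_real (a * (t - b)) :: complex) has_vector_derivative of_real a) (at y)"
    by (intro has_vector_derivative_of_real) (auto intro!: derivative_eq_intros)
  then have "((\<lambda>t. 2 * of_real pi * \<i> * of_real (a * (t - b))) has_vector_derivative
      2 * of_real pi * \<i> * of_real a) (at y)"
    by (rule has_vector_derivative_mult_right)
  from field_vector_diff_chain_at[OF this DERIV_exp]
  show ?thesis by (simp add: o_def e_def)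
qed

lemma D_algD:
  assumes "\<Phi> \<in> D_alg c \<nu>"
  shows "smooth (\<lambda>x y. \<Phi> x y p)"
    and "\<Phi> (x + of_int k) y p = e (of_int (c * k * p) * (y - of_int p * \<nu>)) * \<Phi> x y p"
    and "\<exists>C. \<forall>x\<in>{0..1}. \<forall>y p. \<bar>of_int p\<bar> ^ n * norm (iter_partial ds (\<lambda>x y. \<Phi> x y p) x y) \<le> C"
proof -
  have sr: "smooth_rapid \<Phi>" and
    cov: "cnj (e (of_int (c * k * p) * (y - of_int p * \<nu>))) * \<Phi> (x + of_int k) y p = \<Phi> x y p"
    using assms unfolding D_alg_def by blast+
  show "smooth (\<lambda>x y. \<Phi> x y p)" using sr unfolding smooth_rapid_def by blast
  show "\<exists>C. \<forall>x\<in>{0..1}. \<forall>y p. \<bar>of_int p\<bar> ^ n * norm (iter_partial ds (\<lambda>x y. \<Phi> x y p) x y) \<le> C"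
    using sr unfolding smooth_rapid_def by blast
  show "\<Phi> (x + of_int k) y p = e (of_int (c * k * p) * (y - of_int p * \<nu>)) * \<Phi> x y p"
    unfolding cov[symmetric] mult.assoc[symmetric] e_mult_cnj by simp
qed

text \<open>
  Differentiating the covariance condition: \<open>dx \<Phi>\<close> is covariant again, whereas \<open>dy \<Phi>\<close> acquires the
  derivative \<open>2 \<pi> \<i> c k p\<close> of the phase.
\<close>

lemma D_alg_partial_translate:
  assumes "\<Phi> \<in> D_alg c \<nu>"
  defines "E \<equiv> \<lambda>k y p. e (of_int (c * k * p) * (y - of_int p * \<nu>))"
  shows "dx (\<lambda>x y. \<Phi> x y p) (x + of_int k) y = E k y p * dx (\<lambda>x y. \<Phi> x y p) x y"
    and "dy (\<lambda>x y. \<Phi> x y p) (x + of_int k) y =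
      E k y p * (2 * of_real pi * \<i> * of_int (c * k * p) * \<Phi> x y p + dy (\<lambda>x y. \<Phi> x y p) x y)"
proof -
  note sm = D_algD(1)[OF assms(1), of p]
  have "((\<lambda>s. \<Phi> (s + of_int k) y p) has_vector_derivative dx (\<lambda>x y. \<Phi> x y p) (x + of_int k) y) (at x)"
    by (rule has_vector_derivative_shift) (rule smoothD(2)[OF sm])
  moreover have "((\<lambda>s. \<Phi> (s + of_int k) y p) has_vector_derivative E k y p * dx (\<lambda>x y. \<Phi> x y p) x y) (at x)"
    unfolding D_algD(2)[OF assms(1)] E_def
    by (intro has_vector_derivative_mult_right smoothD(2)[OF sm])
  ultimately show "dx (\<lambda>x y. \<Phi> x y p) (x + of_int k) y = E k y p * dx (\<lambda>x y. \<Phi> x y p) x y"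
    by (rule vector_derivative_unique_at)
  have "((\<lambda>t. \<Phi> (x + of_int k) t p) has_vector_derivative dy (\<lambda>x y. \<Phi> x y p) (x + of_int k) y) (at y)"
    by (rule smoothD(3)[OF sm])
  moreover have "((\<lambda>t. \<Phi> (x + of_int k) t p) has_vector_derivative
      (E k y p * dy (\<lambda>x y. \<Phi> x y p) x y +
       2 * of_real pi * \<i> * of_real (of_int (c * k * p)) * E k y p * \<Phi> x y p)) (at y)"
    unfolding D_algD(2)[OF assms(1)] E_def
    by (intro has_vector_derivative_mult has_vector_derivative_e smoothD(3)[OF sm])
  ultimately show "dy (\<lambda>x y. \<Phi> x y p) (x + of_int k) y =
      E k y p * (2 * of_real pi * \<i> * of_int (c * k * p) * \<Phi> x y p + dy (\<lambda>x y. \<Phi> x y p) x y)"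
    using vector_derivative_unique_at by (fastforce simp: algebra_simps)
qed

text \<open>
  Rapid decay is only given for \<open>x\<close> in compact sets; covariance transports the bounds on \<open>[0, 1]\<close> to the
  whole line. For \<open>dy \<Phi>\<close> the extra term has the factor \<open>k\<close>, the integer part of \<open>x\<close>, and a factor \<open>p\<close> that is
  absorbed by the decay of \<open>\<Phi>\<close> in \<open>p\<close>. This leaves linear growth in \<open>x\<close>.
\<close>

lemma D_alg_bounds:
  assumes "\<Phi> \<in> D_alg c \<nu>"
  obtains C where "0 \<le> C" "\<And>x y p. norm (\<Phi> x y p) \<le> C"
    "\<And>x y p. norm (dx (\<lambda>x y. \<Phi> x y p) x y) \<le> C"
    "\<And>x y p. norm (dy (\<lambda>x y. \<Phi> x y p) x y) \<le> C * (1 + \<bar>x\<bar>)"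
proof -
  obtain C0 where C0: "\<forall>x\<in>{0..1}. \<forall>y p. norm (\<Phi> x y p) \<le> C0"
    using D_algD(3)[OF assms, of 0 "[]"] by auto
  obtain C1 where C1: "\<forall>x\<in>{0..1}. \<forall>y p. \<bar>of_int p\<bar> * norm (\<Phi> x y p) \<le> C1"
    using D_algD(3)[OF assms, of 1 "[]"] by auto
  obtain C2 where C2: "\<forall>x\<in>{0..1}. \<forall>y p. norm (dx (\<lambda>x y. \<Phi> x y p) x y) \<le> C2"
    using D_algD(3)[OF assms, of 0 "[True]"] by (auto simp: iter_partial_Cons)
  obtain C3 where C3: "\<forall>x\<in>{0..1}. \<forall>y p. norm (dy (\<lambda>x y. \<Phi> x y p) x y) \<le> C3"
    using D_algD(3)[OF assms, of 0 "[False]"] by (auto simp: iter_partial_Cons)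
  have nn: "0 \<le> C0" "0 \<le> C1" "0 \<le> C2" "0 \<le> C3"
    using C0[rule_format, of 0 0 0] C1[rule_format, of 0 0 0] C2[rule_format, of 0 0 0]
      C3[rule_format, of 0 0 0] by (auto intro: order_trans[OF norm_ge_zero])
  define a where "a = 2 * pi * \<bar>of_int c\<bar> * C1"
  have a: "0 \<le> a" using nn by (simp add: a_def)
  let ?C = "C0 + C2 + C3 + a"
  show ?thesis
  proof (rule that[of ?C])
    show "0 \<le> ?C" using nn a by simp
    fix x y :: real and p :: int
    define k where "k = \<lfloor>x\<rfloor>"
    define z where "z = x - of_int k"
    have z: "z \<in> {0..1}" and x: "x = z + of_int k"
      unfolding z_def k_def atLeastAtMost_iff by linarith+
    have k: "\<bar>of_int k\<bar> \<le> 1 + \<bar>x\<bar>" unfolding k_def by linarith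
    show "norm (\<Phi> x y p) \<le> ?C"
      using C0[rule_format, OF z, of y p] nn a unfolding x D_algD(2)[OF assms] by (simp add: norm_mult)
    show "norm (dx (\<lambda>x y. \<Phi> x y p) x y) \<le> ?C"
      using C2[rule_format, OF z, of p y] nn a unfolding x D_alg_partial_translate[OF assms] by (simp add: norm_mult)
    have "norm (dy (\<lambda>x y. \<Phi> x y p) x y)
        \<le> norm (2 * of_real pi * \<i> * of_int (c * k * p) * \<Phi> z y p) + norm (dy (\<lambda>x y. \<Phi> x y p) z y)"
      unfolding x D_alg_partial_translate[OF assms] norm_mult norm_e mult_1
      by (rule order_trans[OF norm_triangle_ineq]) (simp add: norm_mult)
    also have "norm (2 * of_real pi * \<i> * of_int (c * k * p) * \<Phi> z y p)
        = 2 * pi * \<bar>of_int c\<bar> * \<bar>of_int k\<bar> * (\<bar>of_int p\<bar> * norm (\<Phi> z y p))"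
      by (simp add: norm_mult abs_mult)
    also have "\<dots> \<le> 2 * pi * \<bar>of_int c\<bar> * \<bar>of_int k\<bar> * C1"
      by (intro mult_left_mono C1[rule_format] z) auto
    also have "\<dots> = a * \<bar>of_int k\<bar>" by (simp add: a_def)
    also have "\<dots> \<le> a * (1 + \<bar>x\<bar>)" using k a by (intro mult_left_mono)
    also have "a * (1 + \<bar>x\<bar>) + norm (dy (\<lambda>x y. \<Phi> x y p) z y) \<le> a * (1 + \<bar>x\<bar>) + C3 * (1 + \<bar>x\<bar>)"
    proof -
      have "C3 * 1 \<le> C3 * (1 + \<bar>x\<bar>)" using nn by (intro mult_left_mono) auto
      then show ?thesis using C3[rule_format, OF z, of p y] by simp
    qed
    also have "\<dots> = (a + C3) * (1 + \<bar>x\<bar>)" by (simp add: ring_distribs)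
    also have "\<dots> \<le> ?C * (1 + \<bar>x\<bar>)" using nn a by (intro mult_right_mono) auto
    finally show "norm (dy (\<lambda>x y. \<Phi> x y p) x y) \<le> ?C * (1 + \<bar>x\<bar>)" by simp
  qed
qed

lemma moderate_D_alg:
  assumes "\<Phi> \<in> D_alg c \<nu>"
  shows "moderate (\<lambda>q x y. \<Phi> (x + of_int q * l) (y + of_int q * k) q)"
    and "moderate (\<lambda>q x y. dx (\<lambda>x y. \<Phi> x y q) (x + of_int q * l) (y + of_int q * k))"
    and "moderate (\<lambda>q x y. dy (\<lambda>x y. \<Phi> x y q) (x + of_int q * l) (y + of_int q * k))"
proof -
  obtain C where C: "0 \<le> C" "\<And>x y p. norm (\<Phi> x y p) \<le> C"
    "\<And>x y p. norm (dx (\<lambda>x y. \<Phi> x y p) x y) \<le> C"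
    "\<And>x y p. norm (dy (\<lambda>x y. \<Phi> x y p) x y) \<le> C * (1 + \<bar>x\<bar>)"
    using D_alg_bounds[OF assms] by blast
  show "moderate (\<lambda>q x y. \<Phi> (x + of_int q * l) (y + of_int q * k) q)"
    "moderate (\<lambda>q x y. dx (\<lambda>x y. \<Phi> x y q) (x + of_int q * l) (y + of_int q * k))"
    using C by (auto intro!: moderate_norm_le[OF moderate_const[of "of_real C"]])
  have "moderate (\<lambda>q x y. of_real C * (1 + of_real \<bar>x\<bar> + of_real \<bar>l\<bar> * of_real \<bar>of_int q\<bar>))"
    by (intro moderate_intros moderate_norm_le[OF moderate_x] moderate_norm_le[OF moderate_q]) auto
  then show "moderate (\<lambda>q x y. dy (\<lambda>x y. \<Phi> x y q) (x + of_int q * l) (y + of_int q * k))"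
  proof (rule moderate_norm_le)
    fix q :: int and x y
    have "norm (dy (\<lambda>x y. \<Phi> x y q) (x + of_int q * l) (y + of_int q * k)) \<le> C * (1 + \<bar>x + of_int q * l\<bar>)"
      by (rule C)
    also have "\<dots> \<le> C * (1 + \<bar>x\<bar> + \<bar>l\<bar> * \<bar>of_int q\<bar>)"
      using C(1) abs_triangle_ineq[of x "of_int q * l"] by (intro mult_left_mono) (auto simp: abs_mult mult.commute)
    also have "\<dots> = norm (of_real (C * (1 + \<bar>x\<bar> + \<bar>l\<bar> * \<bar>of_int q\<bar>)) :: complex)"
      using C(1) by (simp only: norm_of_real) simp
    finally show "norm (dy (\<lambda>x y. \<Phi> x y q) (x + of_int q * l) (y + of_int q * k))
       \<le> norm (of_real C * (1 + of_real \<bar>x\<bar> + of_real \<bar>l\<bar> * of_real \<bar>of_int q\<bar>) :: complex)"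
      by simp
  qed
qed

text \<open>
  Both sides are sums over \<open>q\<close> of terms evaluated at \<open>(x, y) + q (2 \<mu>, 2 \<nu>)\<close>. Once the left side is
  differentiated termwise, the terms agree by the product rule and the translation rules of the
  phases: what the phases gain under translation is what \<open>\<delta>\<^sub>X\<close> and \<open>\<delta>\<^sub>Z\<close> contribute.
\<close>

lemma heis_conn_D_act:
  assumes \<mu>: "\<mu> \<noteq> 0" and f: "f \<in> Xi" and \<Phi>: "\<Phi> \<in> D_alg c \<nu>"
  shows "heis_conn c \<mu> \<nu> r s W (D_act \<mu> \<nu> f \<Phi>) x y
    = D_act \<mu> \<nu> (heis_conn c \<mu> \<nu> r s W f) \<Phi> x y + D_act \<mu> \<nu> f (delta c \<mu> W \<Phi>) x y"
proof -
  let ?u = "\<lambda>q x. x + of_int q * (2 * \<mu>)" and ?v = "\<lambda>q y. y + of_int q * (2 * \<nu>)"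
  let ?F = "\<lambda>q x y. cnj (\<Phi> (?u q x) (?v q y) q)"
  let ?Fx = "\<lambda>q x y. cnj (dx (\<lambda>x y. \<Phi> x y q) (?u q x) (?v q y))"
  let ?Fy = "\<lambda>q x y. cnj (dy (\<lambda>x y. \<Phi> x y q) (?u q x) (?v q y))"
  let ?g = "heis_conn c \<mu> \<nu> r s W f"
  define T where "T q x y = ?F q x y * f (?u q x) (?v q y)" for q x y
  define Tx where "Tx q x y = ?F q x y * dx f (?u q x) (?v q y) + ?Fx q x y * f (?u q x) (?v q y)" for q x y
  define Ty where "Ty q x y = ?F q x y * dy f (?u q x) (?v q y) + ?Fy q x y * f (?u q x) (?v q y)" for q x y
  define A where "A q x y = ?F q x y * ?g (?u q x) (?v q y)" for q x y
  (* The terms of the second summand on the right, with the derivations written out and the moderate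
     factor in front. The x-coordinate of the translated point enters through u - q mu = x + q mu. *)
  define B where "B q x y = (- 2 * of_real (fst W) * of_real pi * \<i> * of_int c * of_int q * (of_real x + of_int q * of_real \<mu>) * ?F q x y
      + (- of_real (fst W)) * ?Fy q x y + (- of_real (fst (snd W))) * ?Fx q x y
      + (- 2 * of_real (snd (snd W)) * of_real pi * \<i> * of_int q) * ?F q x y) * f (?u q x) (?v q y)" for q x y
  have act: "D_act \<mu> \<nu> h \<Psi> = (\<lambda>x y. \<Sum>\<^sub>\<infinity>q. cnj (\<Psi> (?u q x) (?v q y) q) * h (?u q x) (?v q y))" for h \<Psi>
    by (intro ext) (simp add: D_act_def mult_ac)
  have \<mu>2: "2 * \<mu> \<noteq> 0" using \<mu> by simp
  note mod = moderate_cnj[OF moderate_D_alg(1)[OF \<Phi>]] moderate_cnj[OF moderate_D_alg(2)[OF \<Phi>]]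
    moderate_cnj[OF moderate_D_alg(3)[OF \<Phi>]]
  note rapids = rapid_Xi[OF f] rapid_Xi[OF Xi_partial(1)[OF f]] rapid_Xi[OF Xi_partial(2)[OF f]]
  have dom: "locally_dominated T" "locally_dominated Tx" "locally_dominated Ty" "locally_dominated A" "locally_dominated B"
    unfolding T_def Tx_def Ty_def A_def B_def
    by (intro locally_dominated_add locally_dominated_moderate_rapid[OF _ _ \<mu>2] mod rapids
        rapid_heis_conn f moderate_intros)+
  have "((\<lambda>s. ?F q s y) has_vector_derivative ?Fx q x y) (at x)" for q x y
    by (intro has_vector_derivative_cnj has_vector_derivative_shift[where g = "\<lambda>s. \<Phi> s (?v q y) q"]
        smoothD(2)[OF D_algD(1)[OF \<Phi>]])
  moreover have "((\<lambda>s. f (?u q s) (?v q y)) has_vector_derivative dx f (?u q x) (?v q y)) (at x)" for q x y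
    by (intro has_vector_derivative_shift[where g = "\<lambda>s. f s (?v q y)"] Xi_has_dx f)
  ultimately have "((\<lambda>s. T q s y) has_vector_derivative Tx q x y) (at x)" for q x y
    unfolding T_def Tx_def by (rule has_vector_derivative_mult)
  then have dxs: "dx (D_act \<mu> \<nu> f \<Phi>) x y = (\<Sum>\<^sub>\<infinity>q. Tx q x y)"
    unfolding act T_def[symmetric] by (rule dx_infsum[OF dom(1,2)])
  have "((\<lambda>t. ?F q x t) has_vector_derivative ?Fy q x y) (at y)" for q x y
    by (intro has_vector_derivative_cnj has_vector_derivative_shift[where g = "\<lambda>t. \<Phi> (?u q x) t q"]
        smoothD(3)[OF D_algD(1)[OF \<Phi>]])
  moreover have "((\<lambda>t. f (?u q x) (?v q t)) has_vector_derivative dy f (?u q x) (?v q y)) (at y)" for q x y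
    by (intro has_vector_derivative_shift[where g = "\<lambda>t. f (?u q x) t"] Xi_has_dy f)
  ultimately have "((\<lambda>t. T q x t) has_vector_derivative Ty q x y) (at y)" for q x y
    unfolding T_def Ty_def by (rule has_vector_derivative_mult)
  then have dys: "dy (D_act \<mu> \<nu> f \<Phi>) x y = (\<Sum>\<^sub>\<infinity>q. Ty q x y)"
    unfolding act T_def[symmetric] by (rule dy_infsum[OF dom(1,3)])
  note hs = has_sum_infsum[OF locally_dominated_summable[OF dom(1), of x y]]
    has_sum_infsum[OF locally_dominated_summable[OF dom(2), of x y]]
    has_sum_infsum[OF locally_dominated_summable[OF dom(3), of x y]]
    has_sum_infsum[OF locally_dominated_summable[OF dom(4), of x y]]
    has_sum_infsum[OF locally_dominated_summable[OF dom(5), of x y]]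
  have "((\<lambda>q. of_real (fst W) * (- Ty q x y + \<i> * of_real (X_phase c \<mu> \<nu> r x y) * T q x y) +
     of_real (fst (snd W)) * (- Tx q x y) +
     of_real (snd (snd W)) * (\<i> * of_real (Z_phase \<mu> s x) * T q x y)) has_sum
     heis_conn c \<mu> \<nu> r s W (D_act \<mu> \<nu> f \<Phi>) x y) UNIV"
    unfolding heis_conn_def dxs dys unfolding act T_def[symmetric]
    by (intro has_sum_add has_sum_cmult_right has_sum_uminusI hs)
  moreover have "of_real (fst W) * (- Ty q x y + \<i> * of_real (X_phase c \<mu> \<nu> r x y) * T q x y) +
     of_real (fst (snd W)) * (- Tx q x y) +
     of_real (snd (snd W)) * (\<i> * of_real (Z_phase \<mu> s x) * T q x y) = A q x y + B q x y" for q
    unfolding T_def Tx_def Ty_def A_def B_def heis_conn_def X_phase_translate[OF \<mu>] Z_phase_translate[OF \<mu>]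
    by (simp add: algebra_simps)
  ultimately have "((\<lambda>q. A q x y + B q x y) has_sum heis_conn c \<mu> \<nu> r s W (D_act \<mu> \<nu> f \<Phi>) x y) UNIV"
    by simp
  from has_sum_unique[OF this has_sum_add[OF hs(4,5)]]
  have "heis_conn c \<mu> \<nu> r s W (D_act \<mu> \<nu> f \<Phi>) x y = (\<Sum>\<^sub>\<infinity>q. A q x y) + (\<Sum>\<^sub>\<infinity>q. B q x y)" .
  also have "(\<lambda>q. B q x y) = (\<lambda>q. cnj (delta c \<mu> W \<Phi> (?u q x) (?v q y) q) * f (?u q x) (?v q y))"
    unfolding B_def delta_def delta_X_def delta_Y_def delta_Z_def
    by (intro ext) (simp add: algebra_simps)
  finally show ?thesis unfolding act A_def .
qed

section \<open>Compatibility with the inner product\<close>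

text \<open>
  The same scheme for the sum over \<open>k\<close> that defines the inner product, where \<open>f\<close> and \<open>g\<close> are evaluated
  at points that differ by \<open>p (2 \<mu>, 2 \<nu>)\<close>. The difference of the phases at these points is
  \<open>2 \<pi> c p (x + k - p \<mu>)\<close>. The part without \<open>k\<close> is the multiplication operator in \<open>\<delta>\<^sub>X\<close>, and the part
  with \<open>k\<close> is the derivative of the exponential \<open>P\<close> in front of the summand.
\<close>

lemma heis_conn_inner_D:
  assumes \<mu>: "\<mu> \<noteq> 0" and f: "f \<in> Xi" and g: "g \<in> Xi"
  shows "delta c \<mu> W (inner_D c \<mu> \<nu> f g) x y p
    = inner_D c \<mu> \<nu> (heis_conn c \<mu> \<nu> r s W f) g x y p + inner_D c \<mu> \<nu> f (heis_conn c \<mu> \<nu> r s W g) x y p"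
proof -
  define a where "a = 2 * of_int p * \<mu>"
  define b where "b = 2 * of_int p * \<nu>"
  define P where "P k x y = cnj (e (of_int (c * k * p) * (y - of_int p * \<nu>)))" for k :: int and x y :: real
  define H where "H f g x y = f x y * cnj (g (x - a) (y - b))" for f g :: plane_fun and x y
  (* Step (1, 0) in the form x + k * l, y + k * j to which the majorants apply. *)
  let ?t = "\<lambda>F k x y. F (x + of_int k * 1) (y + of_int k * 0)"
  let ?f = "heis_conn c \<mu> \<nu> r s W f" and ?g = "heis_conn c \<mu> \<nu> r s W g"
  define T where "T k x y = P k x y * ?t (H f g) k x y" for k x y
  define Tx where "Tx k x y = P k x y * ?t (H f (dx g)) k x y + P k x y * ?t (H (dx f) g) k x y" for k x y
  define Ty where "Ty k x y = P k x y * ?t (H f (dy g)) k x y + P k x y * ?t (H (dy f) g) k x y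
     + ((- 2 * of_real pi * \<i> * of_int c * of_int p) * of_int k * P k x y) * ?t (H f g) k x y" for k x y
  define A where "A k x y = P k x y * ?t (H ?f g) k x y" for k x y
  define B where "B k x y = P k x y * ?t (H f ?g) k x y" for k x y
  have inner: "inner_D c \<mu> \<nu> f g x y p = (\<Sum>\<^sub>\<infinity>k. P k x y * ?t (H f g) k x y)" for f g x y
    unfolding inner_D_def P_def H_def a_def b_def by (simp add: algebra_simps)
  have modP: "moderate P"
    unfolding P_def by (rule moderate_norm_le[OF moderate_const[of 1]]) simp
  note rapids = rapid_mult_translate[of _ _ a b, folded H_def] rapid_Xi Xi_partial f g rapid_heis_conn
  have dom: "locally_dominated T" "locally_dominated Tx" "locally_dominated Ty" "locally_dominated A" "locally_dominated B"
    unfolding T_def Tx_def Ty_def A_def B_def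
    by (intro locally_dominated_add locally_dominated_moderate_rapid moderate_intros modP rapids zero_neq_one[symmetric])+
  have H_dx: "((\<lambda>s. H f g s y) has_vector_derivative H f (dx g) x y + H (dx f) g x y) (at x)" for x y
    unfolding H_def
    by (intro has_vector_derivative_mult has_vector_derivative_cnj Xi_has_dx f
        has_vector_derivative_shift[where a = "- a" and g = "\<lambda>s. g s (y - b)", simplified] g)
  have H_dy: "((\<lambda>t. H f g x t) has_vector_derivative H f (dy g) x y + H (dy f) g x y) (at y)" for x y
    unfolding H_def
    by (intro has_vector_derivative_mult has_vector_derivative_cnj Xi_has_dy f
        has_vector_derivative_shift[where a = "- b" and g = "\<lambda>t. g (x - a) t", simplified] g)
  have "((\<lambda>s. T k s y) has_vector_derivative Tx k x y) (at x)" for k x y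
    unfolding T_def Tx_def P_def distrib_left[symmetric]
    by (intro has_vector_derivative_mult_right has_vector_derivative_shift[where g = "\<lambda>s. H f g s (y + of_int k * 0)"] H_dx)
  then have dxs: "dx (\<lambda>x y. inner_D c \<mu> \<nu> f g x y p) x y = (\<Sum>\<^sub>\<infinity>q. Tx q x y)"
    unfolding inner T_def[symmetric] by (rule dx_infsum[OF dom(1,2)])
  have P_dy: "((\<lambda>t. P k x t) has_vector_derivative (- 2 * of_real pi * \<i> * of_int c * of_int p) * of_int k * P k x y) (at y)" for k x y
    using has_vector_derivative_cnj[OF has_vector_derivative_e[of "of_int (c * k * p)" "of_int p * \<nu>" y]]
    unfolding P_def by (simp add: mult_ac)
  have "((\<lambda>t. T k x t) has_vector_derivative Ty k x y) (at y)" for k x y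
    unfolding T_def Ty_def distrib_left[symmetric]
    by (intro has_vector_derivative_mult has_vector_derivative_shift[where g = "\<lambda>t. H f g (x + of_int k * 1) t"] H_dy P_dy)
  then have dys: "dy (\<lambda>x y. inner_D c \<mu> \<nu> f g x y p) x y = (\<Sum>\<^sub>\<infinity>q. Ty q x y)"
    unfolding inner T_def[symmetric] by (rule dy_infsum[OF dom(1,3)])
  note hs = has_sum_infsum[OF locally_dominated_summable[OF dom(1), of x y]]
    has_sum_infsum[OF locally_dominated_summable[OF dom(2), of x y]]
    has_sum_infsum[OF locally_dominated_summable[OF dom(3), of x y]]
    has_sum_infsum[OF locally_dominated_summable[OF dom(4), of x y]]
    has_sum_infsum[OF locally_dominated_summable[OF dom(5), of x y]]
  have "((\<lambda>k. of_real (fst W) * (2 * of_real pi * \<i> * of_int c * of_int p * of_real (x - of_int p * \<mu>) * T k x y + - Ty k x y) +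
     of_real (fst (snd W)) * (- Tx k x y) +
     of_real (snd (snd W)) * (2 * of_real pi * \<i> * of_int p * T k x y)) has_sum
     delta c \<mu> W (inner_D c \<mu> \<nu> f g) x y p) UNIV"
    unfolding delta_def delta_X_def delta_Y_def delta_Z_def dxs dys unfolding inner T_def[symmetric]
      diff_conv_add_uminus[of "_ * infsum _ _"]
    by (intro has_sum_add has_sum_cmult_right has_sum_uminusI hs)
  moreover have "of_real (fst W) * (2 * of_real pi * \<i> * of_int c * of_int p * of_real (x - of_int p * \<mu>) * T k x y + - Ty k x y) +
     of_real (fst (snd W)) * (- Tx k x y) +
     of_real (snd (snd W)) * (2 * of_real pi * \<i> * of_int p * T k x y) = A k x y + B k x y" for k
  proof -
    have X: "X_phase c \<mu> \<nu> r (x + of_int k * 1) (y + of_int k * 0)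
        = X_phase c \<mu> \<nu> r (x + of_int k * 1 - a) (y + of_int k * 0 - b) + 2 * pi * of_int c * of_int p * (x + of_int k - of_int p * \<mu>)"
      using X_phase_translate[OF \<mu>, of c \<nu> r "x + of_int k * 1 - a" "of_int p" "y + of_int k * 0 - b"]
      by (simp add: a_def b_def algebra_simps)
    have Z: "Z_phase \<mu> s (x + of_int k * 1) = Z_phase \<mu> s (x + of_int k * 1 - a) + 2 * pi * of_int p"
      using Z_phase_translate[OF \<mu>, of s "x + of_int k * 1 - a" "of_int p"]
      by (simp add: a_def algebra_simps)
    show ?thesis
      unfolding T_def Tx_def Ty_def A_def B_def H_def heis_conn_def X Z
      by (simp add: algebra_simps)
  qed
  ultimately have "((\<lambda>k. A k x y + B k x y) has_sum delta c \<mu> W (inner_D c \<mu> \<nu> f g) x y p) UNIV"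
    by simp
  from has_sum_unique[OF this has_sum_add[OF hs(4,5)]]
  show ?thesis unfolding inner A_def B_def .
qed

section \<open>Curvature\<close>

lemma dx_smult_i:
  assumes f: "f \<in> Xi" and k: "\<And>x. (k has_real_derivative k' x) (at x)"
  shows "dx (\<lambda>x y. \<i> * of_real (k x) * f x y) = (\<lambda>x y. \<i> * of_real (k x) * dx f x y + \<i> * of_real (k' x) * f x y)"
proof (intro ext)
  fix x y
  have "((\<lambda>s. \<i> * of_real (k s)) has_vector_derivative \<i> * of_real (k' x)) (at x)"
    by (intro has_vector_derivative_mult_right has_vector_derivative_of_real)
      (use k in \<open>simp add: has_real_derivative_iff_has_vector_derivative\<close>)
  from vector_derivative_at[OF has_vector_derivative_mult[OF this Xi_has_dx[OF f]]]
  show "dx (\<lambda>x y. \<i> * of_real (k x) * f x y) x y = \<i> * of_real (k x) * dx f x y + \<i> * of_real (k' x) * f x y"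
    by (simp add: dx_def[of "\<lambda>x y. \<i> * of_real (k x) * f x y"])
qed

lemma heis_conn_basis:
  "heis_conn c \<mu> \<nu> r s hX f = (\<lambda>x y. - dy f x y + \<i> * of_real (X_phase c \<mu> \<nu> r x y) * f x y)"
  "heis_conn c \<mu> \<nu> r s hY f = (\<lambda>x y. - dx f x y)"
  "heis_conn c \<mu> \<nu> r s hZ f = (\<lambda>x y. \<i> * of_real (Z_phase \<mu> s x) * f x y)"
  by (simp_all add: heis_conn_def hX_def hY_def hZ_def)

lemma heis_conn_bracket:
  "heis_conn c \<mu> \<nu> r s (hbracket c hX hY) f = (\<lambda>x y. of_int c * (\<i> * of_real (Z_phase \<mu> s x) * f x y))"
  "heis_conn c \<mu> \<nu> r s (hbracket c hX hZ) f = (\<lambda>x y. 0)"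
  "heis_conn c \<mu> \<nu> r s (hbracket c hY hZ) f = (\<lambda>x y. 0)"
  by (simp_all add: heis_conn_def hX_def hY_def hZ_def hbracket_def)

text \<open>
  The commutator \<open>[\<nabla>\<^sub>X, \<nabla>\<^sub>Y]\<close> is multiplication by \<open>\<i>\<close> times the \<open>x\<close>-derivative of the phase of \<open>\<nabla>\<^sub>X\<close>,
  namely \<open>\<pi> c x / \<mu> - r \<nu>\<close>; mixed partial derivatives cancel. The term in \<open>x\<close> is cancelled by
  \<open>c \<nabla>\<^sub>Z\<close>, and the shift of \<open>\<nabla>\<^sub>Z\<close> remains as \<open>- \<i> c s\<close>.
\<close>

lemma curvature_heis_conn:
  assumes f: "f \<in> Xi"
  shows "curvature c (heis_conn c \<mu> \<nu> r s) hX hY f = (\<lambda>x y. - \<i> * of_real (r * \<nu> + of_int c * s) * f x y)"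
    and "curvature c (heis_conn c \<mu> \<nu> r s) hX hZ f = (\<lambda>x y. 0)"
    and "curvature c (heis_conn c \<mu> \<nu> r s) hY hZ f = (\<lambda>x y. - \<i> * of_real (pi / \<mu>) * f x y)"
proof -
  have dxX: "dx (heis_conn c \<mu> \<nu> r s hX f) x y = - dx (dy f) x y
      + (\<i> * of_real (X_phase c \<mu> \<nu> r x y) * dx f x y + \<i> * of_real (pi * of_int c / \<mu> * x - r * \<nu>) * f x y)" for x y
  proof -
    have "((\<lambda>s. X_phase c \<mu> \<nu> r s y) has_real_derivative (pi * of_int c / \<mu> * x - r * \<nu>)) (at x)"
    proof -
      have "((\<lambda>s. k / 2 * s\<^sup>2 + r * (\<mu> * y - \<nu> * s)) has_real_derivative (k * x - r * \<nu>)) (at x)" for k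
        by (auto intro!: derivative_eq_intros)
      from this[of "pi * of_int c / \<mu>"] show ?thesis
        unfolding X_phase_def by (simp add: mult.commute)
    qed
    then have "((\<lambda>s. \<i> * of_real (X_phase c \<mu> \<nu> r s y)) has_vector_derivative
        \<i> * of_real (pi * of_int c / \<mu> * x - r * \<nu>)) (at x)"
      by (intro has_vector_derivative_mult_right has_vector_derivative_of_real)
        (simp add: has_real_derivative_iff_has_vector_derivative)
    then have "((\<lambda>s. - dy f s y + \<i> * of_real (X_phase c \<mu> \<nu> r s y) * f s y) has_vector_derivative
      - dx (dy f) x y
      + (\<i> * of_real (X_phase c \<mu> \<nu> r x y) * dx f x y + \<i> * of_real (pi * of_int c / \<mu> * x - r * \<nu>) * f x y)) (at x)"
      by (intro has_vector_derivative_add has_vector_derivative_minus has_vector_derivative_mult Xi_has_dx Xi_partial f)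
    then show ?thesis
      unfolding heis_conn_basis dx_def[of "\<lambda>x y. - dy f x y + \<i> * of_real (X_phase c \<mu> \<nu> r x y) * f x y"]
      by (rule vector_derivative_at)
  qed
  have dyY: "dy (heis_conn c \<mu> \<nu> r s hY f) x y = - dy (dx f) x y" for x y
    unfolding heis_conn_basis
    by (simp add: dy_def[of "\<lambda>x y. - dx f x y"] vector_derivative_at
        has_vector_derivative_minus[OF Xi_has_dy[OF Xi_partial(1)[OF f]]])
  have dyZ: "dy (heis_conn c \<mu> \<nu> r s hZ f) x y = \<i> * of_real (Z_phase \<mu> s x) * dy f x y" for x y
    unfolding heis_conn_basis
    by (simp add: dy_def[of "\<lambda>x y. \<i> * of_real (Z_phase \<mu> s x) * f x y"] vector_derivative_at
        has_vector_derivative_mult_right[OF Xi_has_dy[OF f]])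
  have dxZ: "dx (heis_conn c \<mu> \<nu> r s hZ f) x y
      = \<i> * of_real (Z_phase \<mu> s x) * dx f x y + \<i> * of_real (pi / \<mu>) * f x y" for x y
    unfolding heis_conn_basis
  proof (subst dx_smult_i[OF f])
    fix x
    have "((\<lambda>x. k * x + s) has_real_derivative k) (at x)" for k
      by (auto intro!: derivative_eq_intros)
    from this[of "pi / \<mu>"] show "(Z_phase \<mu> s has_real_derivative pi / \<mu>) (at x)"
      unfolding Z_phase_def[abs_def] by simp
  qed simp
  have "curvature c (heis_conn c \<mu> \<nu> r s) hX hY f x y = - \<i> * of_real (r * \<nu> + of_int c * s) * f x y" for x y
    unfolding curvature_def heis_conn_bracket
    unfolding heis_conn_basis(1)[of _ _ _ _ _ "heis_conn c \<mu> \<nu> r s hY f"]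
      heis_conn_basis(2)[of _ _ _ _ _ "heis_conn c \<mu> \<nu> r s hX f"] dxX dyY mixed_partials[OF f]
    unfolding heis_conn_basis Z_phase_def by (simp add: algebra_simps)
  then show "curvature c (heis_conn c \<mu> \<nu> r s) hX hY f = (\<lambda>x y. - \<i> * of_real (r * \<nu> + of_int c * s) * f x y)"
    by blast
  have "curvature c (heis_conn c \<mu> \<nu> r s) hX hZ f x y = 0" for x y
    unfolding curvature_def heis_conn_bracket
    unfolding heis_conn_basis(1)[of _ _ _ _ _ "heis_conn c \<mu> \<nu> r s hZ f"]
      heis_conn_basis(3)[of _ _ _ _ _ "heis_conn c \<mu> \<nu> r s hX f"] dyZ
    unfolding heis_conn_basis by (simp add: algebra_simps)
  then show "curvature c (heis_conn c \<mu> \<nu> r s) hX hZ f = (\<lambda>x y. 0)" by blast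
  have "curvature c (heis_conn c \<mu> \<nu> r s) hY hZ f x y = - \<i> * of_real (pi / \<mu>) * f x y" for x y
    unfolding curvature_def heis_conn_bracket
    unfolding heis_conn_basis(2)[of _ _ _ _ _ "heis_conn c \<mu> \<nu> r s hZ f"]
      heis_conn_basis(3)[of _ _ _ _ _ "heis_conn c \<mu> \<nu> r s hY f"] dxZ
    unfolding heis_conn_basis by (simp add: algebra_simps)
  then show "curvature c (heis_conn c \<mu> \<nu> r s) hY hZ f = (\<lambda>x y. - \<i> * of_real (pi / \<mu>) * f x y)" by blast
qed

section \<open>Scalars in the endomorphism algebra\<close>

lemma iter_partial_const: "iter_partial ds (\<lambda>x y. a) = (\<lambda>x y. if ds = [] then a else 0)"
proof (induction ds)
  case (Cons b ds)
  have "dx (\<lambda>x y. k) = (\<lambda>x y. 0)" "dy (\<lambda>x y. k) = (\<lambda>x y. 0)" for k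
    by (simp_all add: dx_def dy_def)
  with Cons show ?case by (simp add: iter_partial_Cons)
qed simp

lemma scalar_E_alg: "(\<lambda>x y p. a * Id_E x y p) \<in> E_alg c \<mu> \<nu>"
proof -
  have Id: "Id_E x y p = of_bool (p = 0)" for x y p by (simp add: Id_E_def)
  have "\<exists>C. \<forall>x\<in>{l..u}. \<forall>y p. \<bar>of_int p\<bar> ^ n * norm (iter_partial ds (\<lambda>x y. a * Id_E x y p) x y) \<le> C"
    for ds n and l u :: real
    unfolding Id iter_partial_const
    by (intro exI[of _ "norm a"]) (auto simp: power_0_left)
  moreover have "smooth (\<lambda>x y. a * Id_E x y p)" for p
    unfolding smooth_def Id iter_partial_const by simp
  ultimately show ?thesis
    by (auto simp: E_alg_def smooth_rapid_def Id e_def)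
qed

lemma E_act_scalar: "E_act (\<lambda>x y p. a * Id_E x y p) f = (\<lambda>x y. cnj a * f x y)"
proof (intro ext)
  fix x y
  have "(\<lambda>q. cnj (a * Id_E x y q) * f (x + of_int q) y) = (\<lambda>q. if q = 0 then cnj a * f x y else 0)"
    by (auto simp: Id_E_def)
  then show "E_act (\<lambda>x y p. a * Id_E x y p) f x y = cnj a * f x y"
    unfolding E_act_def using infsumI[OF has_sum_int_single] by simp
qed

lemma E_mult_scalar:
  "E_mult (\<lambda>x y p. a * Id_E x y p) (\<lambda>x y p. b * Id_E x y p) = (\<lambda>x y p. a * b * Id_E x y p)"
proof (intro ext)
  fix x y p
  have "(\<lambda>q. a * Id_E x y q * (b * Id_E (x + of_int q) y (p - q))) = (\<lambda>q. if q = 0 then a * b * Id_E x y p else 0)"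
    by (auto simp: Id_E_def)
  then show "E_mult (\<lambda>x y p. a * Id_E x y p) (\<lambda>x y p. b * Id_E x y p) x y p = a * b * Id_E x y p"
    unfolding E_mult_def using infsumI[OF has_sum_int_single] by simp
qed

lemma scalar_E_skew: "cnj a = - a \<Longrightarrow> (\<lambda>x y p. a * Id_E x y p) \<in> E_skew c \<mu> \<nu>"
  using scalar_E_alg[of a c \<mu> \<nu>] by (auto simp: E_skew_def E_star_def Id_E_def)

section \<open>The Yang--Mills functional on the family\<close>

text \<open>
  Faithfulness of the left action makes the inducing element unique, so that the definite description
  in the definition of the curvature element denotes it.
\<close>

lemma curvature_elem_eqI:
  assumes "induces_curvature c \<mu> \<nu> nab W W' \<Theta>"
  shows "curvature_elem c \<mu> \<nu> nab W W' = \<Theta>"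
  unfolding curvature_elem_def
proof (rule the_equality[of "induces_curvature c \<mu> \<nu> nab W W'", OF assms])
  fix \<Theta>' assume "induces_curvature c \<mu> \<nu> nab W W' \<Theta>'"
  with assms show "\<Theta>' = \<Theta>"
    by (intro E_act_faithful) (auto simp: induces_curvature_def E_alg_def)
qed

lemma induces_curvature_scalar:
  assumes "\<And>f. f \<in> Xi \<Longrightarrow> curvature c nab W W' f = (\<lambda>x y. cnj a * f x y)"
  shows "induces_curvature c \<mu> \<nu> nab W W' (\<lambda>x y p. a * Id_E x y p)"
  using assms by (simp add: induces_curvature_def E_act_scalar scalar_E_alg)

lemma induces_curvature_heis_conn:
  "induces_curvature c \<mu> \<nu> (heis_conn c \<mu> \<nu> r s) hX hY (\<lambda>x y p. \<i> * of_real (r * \<nu> + of_int c * s) * Id_E x y p)"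
  "induces_curvature c \<mu> \<nu> (heis_conn c \<mu> \<nu> r s) hX hZ (\<lambda>x y p. 0 * Id_E x y p)"
  "induces_curvature c \<mu> \<nu> (heis_conn c \<mu> \<nu> r s) hY hZ (\<lambda>x y p. \<i> * of_real (pi / \<mu>) * Id_E x y p)"
  by (rule induces_curvature_scalar; simp add: curvature_heis_conn)+

lemma YM_heis_conn:
  "YM c \<mu> \<nu> (heis_conn c \<mu> \<nu> r s) = 2 * \<bar>\<mu>\<bar> * ((r * \<nu> + of_int c * s)\<^sup>2 + (pi / \<mu>)\<^sup>2)"
proof -
  have sq: "(\<lambda>x y p. \<i> * of_real a * (\<i> * of_real a) * Id_E x y p + 0 * 0 * Id_E x y p + \<i> * of_real b * (\<i> * of_real b) * Id_E x y p)
      = (\<lambda>x y p. of_real (- a\<^sup>2 - b\<^sup>2) * Id_E x y p)" for a b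
    by (simp add: algebra_simps power2_eq_square)
  have "YM c \<mu> \<nu> (heis_conn c \<mu> \<nu> r s) = - Re (tau_E \<mu> (\<lambda>x y p.
      of_real (- (r * \<nu> + of_int c * s)\<^sup>2 - (pi / \<mu>)\<^sup>2) * Id_E x y p))"
    unfolding YM_def Let_def induces_curvature_heis_conn[THEN curvature_elem_eqI] E_mult_scalar sq ..
  also have "\<dots> = 2 * \<bar>\<mu>\<bar> * ((r * \<nu> + of_int c * s)\<^sup>2 + (pi / \<mu>)\<^sup>2)"
    by (simp add: tau_E_def Id_E_def algebra_simps)
  finally show ?thesis .
qed

lemma heis_conn_rules:
  assumes "\<mu> \<noteq> 0"
  shows "compatible_connection_rules c \<mu> \<nu> (heis_conn c \<mu> \<nu> r s)"
  unfolding compatible_connection_rules_def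
proof (intro conjI ballI allI)
  show "linear (\<lambda>W. heis_conn c \<mu> \<nu> r s W f x y)" for f x y
    by (rule linearI) (simp_all add: heis_conn_def algebra_simps scaleR_conv_of_real)
  show "heis_conn c \<mu> \<nu> r s W (\<lambda>x y. f x y + g x y) x y
      = heis_conn c \<mu> \<nu> r s W f x y + heis_conn c \<mu> \<nu> r s W g x y" if "f \<in> Xi" "g \<in> Xi" for W f g x y
    unfolding heis_conn_def dx_add[OF that] dy_add[OF that] by (simp add: algebra_simps)
  show "heis_conn c \<mu> \<nu> r s W (\<lambda>x y. a * f x y) x y = a * heis_conn c \<mu> \<nu> r s W f x y" if "f \<in> Xi" for W f a x y
    unfolding heis_conn_def dx_cmult[OF that] dy_cmult[OF that] by (simp add: algebra_simps)
qed (use assms heis_conn_D_act heis_conn_inner_D in auto)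

text \<open>
  The left action conjugates, so the element \<open>\<i> Id\<close> acts as \<open>- \<i>\<close>; hence the sign of \<open>t\<close>.
\<close>

lemma perturb_heis_conn:
  "perturb (heis_conn c \<mu> \<nu> r s) (\<lambda>W x y p. \<i> * of_real (snd (snd W)) * Id_E x y p) t = heis_conn c \<mu> \<nu> r (s - t)"
  unfolding perturb_def E_act_scalar
  by (intro ext) (simp add: heis_conn_def Z_phase_def algebra_simps)

theorem proposition3p6:
  fixes c :: int and \<mu> \<nu> :: real and nab1 :: conn
  assumes "c \<ge> 1" and "\<mu> \<noteq> 0" and "\<nu> \<noteq> 0"
    and "\<And>f x y. linear (\<lambda>W. nab1 W f x y)"
    and "\<And>f x y. nab1 hX f x y = - dy f x y +
           (of_real pi * of_int c * \<i> / (2 * of_real \<mu>) * (of_real x)\<^sup>2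
              - of_real \<nu> * \<i> * of_real x + of_real \<mu> * \<i> * of_real y) * f x y"
    and "\<And>f x y. nab1 hY f x y = - dx f x y"
    and "\<And>f x y. nab1 hZ f x y = of_real pi * \<i> * of_real x / of_real \<mu> * f x y"
  shows "compatible_connection_rules c \<mu> \<nu> nab1 \<and>
    induces_curvature c \<mu> \<nu> nab1 hX hY (\<lambda>x y p. of_real \<nu> * \<i> * Id_E x y p) \<and>
    induces_curvature c \<mu> \<nu> nab1 hX hZ (\<lambda>x y p. 0) \<and>
    induces_curvature c \<mu> \<nu> nab1 hY hZ (\<lambda>x y p. of_real pi * \<i> / of_real \<mu> * Id_E x y p) \<and>
    \<not> critical_point c \<mu> \<nu> nab1 \<and> \<not> minimizer c \<mu> \<nu> nab1"
proof -
  have nab1: "nab1 = heis_conn c \<mu> \<nu> 1 0"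
  proof (intro ext)
    fix W :: heis and f x y
    obtain w1 w2 w3 where W: "W = (w1, w2, w3)" by (cases W)
    interpret lin: linear "\<lambda>W. nab1 W f x y" by fact
    have "W = w1 *\<^sub>R hX + (w2 *\<^sub>R hY + w3 *\<^sub>R hZ)" by (simp add: W hX_def hY_def hZ_def)
    then have "nab1 W f x y = w1 *\<^sub>R nab1 hX f x y + (w2 *\<^sub>R nab1 hY f x y + w3 *\<^sub>R nab1 hZ f x y)"
      by (simp only: lin.add lin.scale)
    also have "\<dots> = heis_conn c \<mu> \<nu> 1 0 W f x y"
      unfolding assms(5-7)
      by (simp add: W heis_conn_def X_phase_def Z_phase_def scaleR_conv_of_real algebra_simps)
    finally show "nab1 W f x y = heis_conn c \<mu> \<nu> 1 0 W f x y" .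
  qed
  (* The central direction Z gives a nonzero first variation. *)
  have "\<not> critical_point c \<mu> \<nu> nab1"
  proof
    assume crit: "critical_point c \<mu> \<nu> nab1"
    let ?H = "\<lambda>W x y p. \<i> * of_real (snd (snd W)) * Id_E x y p :: complex"
    have "skew_direction c \<mu> \<nu> ?H"
      unfolding skew_direction_def
    proof (intro conjI allI)
      show "?H W \<in> E_skew c \<mu> \<nu>" for W
        by (rule scalar_E_skew) simp
      show "linear (\<lambda>W. ?H W x y p)" for x y p
        by (rule linearI) (simp_all add: algebra_simps scaleR_conv_of_real)
    qed
    with crit have "((\<lambda>t. YM c \<mu> \<nu> (perturb nab1 ?H t)) has_real_derivative 0) (at 0)"
      unfolding critical_point_def by blast
    then have "((\<lambda>t. 2 * \<bar>\<mu>\<bar> * ((\<nu> - of_int c * t)\<^sup>2 + (pi / \<mu>)\<^sup>2)) has_real_derivative 0) (at 0)"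
      unfolding nab1 perturb_heis_conn YM_heis_conn by simp
    moreover have "((\<lambda>t. 2 * \<bar>\<mu>\<bar> * ((\<nu> - of_int c * t)\<^sup>2 + (pi / \<mu>)\<^sup>2)) has_real_derivative
        - 4 * \<bar>\<mu>\<bar> * of_int c * \<nu>) (at 0)"
      by (auto intro!: derivative_eq_intros)
    ultimately have "- 4 * \<bar>\<mu>\<bar> * of_int c * \<nu> = 0" by (rule DERIV_unique[symmetric])
    with assms(1-3) show False by simp
  qed
  moreover have "\<not> minimizer c \<mu> \<nu> nab1"
  proof
    assume "minimizer c \<mu> \<nu> nab1"
    moreover have "heis_conn c \<mu> \<nu> 0 0 \<in> CC c \<mu> \<nu>"
      using heis_conn_Xi heis_conn_rules[OF assms(2)] by (auto simp: CC_def)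
    ultimately have "YM c \<mu> \<nu> nab1 \<le> YM c \<mu> \<nu> (heis_conn c \<mu> \<nu> 0 0)"
      unfolding minimizer_def by blast
    then have "\<bar>\<mu>\<bar> * \<nu>\<^sup>2 \<le> 0"
      unfolding nab1 YM_heis_conn by (simp add: algebra_simps)
    with assms(2,3) show False by (simp add: mult_le_0_iff)
  qed
  ultimately show ?thesis
    using heis_conn_rules[OF assms(2), of c \<nu> 1 0] induces_curvature_heis_conn[of c \<mu> \<nu> 1 0]
    unfolding nab1 by (simp add: mult_ac)
qed

end
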